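(* Let $p$ be a prime, $m$ a positive integer, $q=p^m$ with $q>2$, and $n=q^2+1$. Let $\lambda\in\mathbb{F}_{q^2}^*$ have multiplicative order $r$, where $r\mid(q+1)$ and $\nu_2(r)=\nu_2(q+1)$. Let $\delta\in\mathbb{F}_{q^4}$ be a primitive $rn$-th root of unity with $\delta^n=\lambda$. Let $g_1(x)=(x-\delta)(x-\delta^{q^2})$ and $g_{q^2+q+1}(x)=(x-\delta^{q^2+q+1})(x-\delta^{q^4+q^3+q^2})$ (the minimal polynomials over $\mathbb{F}_{q^2}$ of $\delta$ and $\delta^{q^2+q+1}$), and let $\mathcal{C}(1,q^2+q+1)$ be the $\lambda$-constacyclic code of length $n$ over $\mathbb{F}_{q^2}$ with check polynomial $g_1(x)g_{q^2+q+1}(x)$. Then $\mathcal{C}(1,q^2+q+1)$ has parameters $[q^2+1,4,q^2-q]$ and weight enumerator \[ 1+(q^5-q)z^{q^2-q}+\frac{(q^4-1)(q-1)q^3}{2}\left(z^{q^2-1}+z^{q^2+1}\right)+(q^7-q^5+q^4-q^3+q-1)z^{q^2}. \] Furthermore, the supports of the minimum weight codewords of $\mathcal{C}(1,q^2+q+1)$ form a $3$-$(q^2+1,q^2-q,(q^2-q-1)(q-2))$ design. The dual code $\mathcal{C}(1,q^2+q+1)^\perp$ has parameters $[q^2+1,q^2-3,4]$, and the supports of its minimum weight codewords form a $3$-$(q^2+1,4,q-2)$ design.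
   Context: $\nu_2$ is the $2$-adic valuation. A $\lambda$-constacyclic code of length $n$ over $\mathbb{F}_{q^2}$ is an ideal of $\mathbb{F}_{q^2}[x]/\langle x^n-\lambda\rangle$ (identifying $(c_0,\dots,c_{n-1})$ with $\sum c_ix^i$); its check polynomial $h(x)$ is $(x^n-\lambda)/g(x)$ where $g$ is the monic generator polynomial. The weight enumerator is $\sum_i A_iz^i$ with $A_i$ the number of codewords of Hamming weight $i$. A $t$-$(v,\kappa,\eta)$ design is a set of $\kappa$-subsets (blocks) of a $v$-set such that every $t$-subset lies in exactly $\eta$ blocks; here the point set is the coordinate set $\{0,\dots,n-1\}$ and the blocks are the distinct supports of codewords of the given weight. *)

theory Defs
  imports "HOL-Computational_Algebra.Computational_Algebra"
begin

definition mult_ord :: "'a::field \<Rightarrow> nat" where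
  "mult_ord x = (LEAST k. 0 < k \<and> x ^ k = 1)"

definition subfield_of_order :: "nat \<Rightarrow> 'a::field set" where
  "subfield_of_order Q = {x. x ^ Q = x}"

text \<open>Vectors of length n over F are represented as polynomials
  c_0 + c_1 x + ... + c_{n-1} x^(n-1) with coefficients in F.\<close>
definition words :: "'a::field set \<Rightarrow> nat \<Rightarrow> 'a poly set" where
  "words F n = {c. (\<forall>i. coeff c i \<in> F) \<and> (\<forall>i\<ge>n. coeff c i = 0)}"

text \<open>The ideal of F[x]/(x^n - lambda) generated by g, represented by
  remainders modulo x^n - lambda.\<close>
definition constacyclic_code_gen :: "'a::field set \<Rightarrow> nat \<Rightarrow> 'a \<Rightarrow> 'a poly \<Rightarrow> 'a poly set" where
  "constacyclic_code_gen F n lam g =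
     {c \<in> words F n. \<exists>a. (\<forall>i. coeff a i \<in> F) \<and> c = (a * g) mod (monom 1 n - [:lam:])}"

definition constacyclic_code_check :: "'a::field set \<Rightarrow> nat \<Rightarrow> 'a \<Rightarrow> 'a poly \<Rightarrow> 'a poly set" where
  "constacyclic_code_check F n lam h =
     constacyclic_code_gen F n lam ((monom 1 n - [:lam:]) div h)"

definition supp :: "'a::zero poly \<Rightarrow> nat set" where
  "supp c = {i. coeff c i \<noteq> 0}"

definition hwt :: "'a::zero poly \<Rightarrow> nat" where
  "hwt c = card (supp c)"

definition min_dist :: "'a::zero poly set \<Rightarrow> nat" where
  "min_dist C = Min (hwt ` (C - {0}))"

definition code_dim :: "'a set \<Rightarrow> 'a poly set \<Rightarrow> nat" where
  "code_dim F C = (THE k. card C = card F ^ k)"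

definition weight_enumerator :: "'a::zero poly set \<Rightarrow> int poly" where
  "weight_enumerator C = (\<Sum>c\<in>C. monom 1 (hwt c))"

definition dual_code :: "'a::field set \<Rightarrow> nat \<Rightarrow> 'a poly set \<Rightarrow> 'a poly set" where
  "dual_code F n C = {v \<in> words F n. \<forall>c\<in>C. (\<Sum>i<n. coeff v i * coeff c i) = 0}"

definition min_weight_supports :: "'a::zero poly set \<Rightarrow> nat set set" where
  "min_weight_supports C = {supp c | c. c \<in> C \<and> c \<noteq> 0 \<and> hwt c = min_dist C}"

definition is_t_design :: "nat \<Rightarrow> nat \<Rightarrow> nat \<Rightarrow> nat \<Rightarrow> nat set set \<Rightarrow> bool" where
  "is_t_design t v k eta B \<longleftrightarrow>
     (\<forall>b\<in>B. b \<subseteq> {..<v} \<and> card b = k) \<and>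
     (\<forall>T. T \<subseteq> {..<v} \<and> card T = t \<longrightarrow> card {b\<in>B. T \<subseteq> b} = eta)"

end

theory Submission
  imports Defs
begin

text \<open>
  With \<open>h\<close> the check polynomial and \<open>g * h = x\<^sup>n - \<lambda>\<close>, the code is \<open>{g * s | s. degree s < 4}\<close> and a
  codeword has coordinates \<open>c\<^sub>i = \<Sum>\<rho>. a\<^sub>\<rho> * \<rho>\<^sup>-\<^sup>i\<close>, summed over the four roots of \<open>h\<close>. Choose \<open>\<omega>\<close> with
  \<open>\<omega>\<close> to the power \<open>q - 1\<close> equal to \<open>1 / \<delta>\<close>. By the conditions on \<open>r\<close>, the elements \<open>w = \<omega>\<^sup>i\<close> for \<open>i < n\<close>
  represent the points of the projective line over \<open>F\<close>, and \<open>c\<^sub>i\<close> is, up to a nonzero factor, the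
  value at \<open>(w, w)\<close> of a form that is linear in one argument and \<open>q\<close>-semilinear in the other.
  Rescaling three zeros of such a form to \<open>w1\<close>, \<open>w2\<close>, \<open>w1 + w2\<close> turns it into a multiple of \<open>x * y\<^sup>q - x\<^sup>q * y\<close>. So a nonzero codeword with
  three zeros vanishes exactly on the Baer subline (circle) through them, which has \<open>q + 1\<close> points and
  depends only on the three zeros.

  Everything else is counting. Any three coordinates are independent on the code, so the numbers of
  words with \<open>0, 1, 2, q + 1\<close> zeros follow from the first moments. The circles form an
  inversive plane, whose complement is the first design. Four coordinates are dependent exactly when
  they are concyclic, and these quadruples are the supports of the weight-4 words of the dual.
\<close>

subsection \<open>Finite fields\<close>

text \<open>Multiplication by \<open>x\<close> permutes the nonzero elements, so their product,
  itself nonzero, absorbs the extra factor.\<close>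

lemma power_card_UNIV_minus_1:
  fixes x :: "'a::{field,finite}"
  assumes "x \<noteq> 0"
  shows "x ^ (card (UNIV :: 'a set) - 1) = 1"
proof -
  have "x ^ (card (UNIV :: 'a set) - 1) * \<Prod>(UNIV - {0}) = (\<Prod>y\<in>UNIV - {0}. x * y)"
    by (simp add: prod.distrib)
  also have "\<dots> = \<Prod>(UNIV - {0})"
    using assms by (intro prod.reindex_bij_witness[of _ "\<lambda>y. y / x" "(*) x"]) auto
  finally show ?thesis by simp
qed

lemma card_power_eq_le:
  fixes u :: "'a::{field,finite}"
  assumes "e > 0"
  shows "card {x. x ^ e = u} \<le> e"
proof -
  have "coeff (monom 1 e - [:u:]) e = 1"
    using assms by (simp add: coeff_pCons split: nat.split)
  hence "monom 1 e - [:u:] \<noteq> 0" by (metis coeff_0 zero_neq_one)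
  from card_poly_roots_bound[OF this]
  have "card {x. x ^ e = u} \<le> degree (monom 1 e - [:u:])"
    by (simp add: poly_monom)
  also have "\<dots> \<le> e"
    by (intro degree_diff_le) (auto simp: degree_monom_le)
  finally show ?thesis .
qed

text \<open>For additive maps the fibres are controlled by the kernel, so this fibre bound does the
  work of rank and nullity below.\<close>

lemma card_le_card_image:
  assumes "finite A" "\<And>y. y \<in> f ` A \<Longrightarrow> card {x\<in>A. f x = y} \<le> k"
  shows "card A \<le> k * card (f ` A)"
proof -
  have "A = (\<Union>y\<in>f ` A. {x\<in>A. f x = y})" by auto
  hence "card A \<le> (\<Sum>y\<in>f ` A. card {x\<in>A. f x = y})"
    using card_UN_le[of "f ` A" "\<lambda>y. {x\<in>A. f x = y}"] assms(1) by simp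
  also have "\<dots> \<le> (\<Sum>y\<in>f ` A. k)"
    using assms(2) by (intro sum_mono)
  finally show ?thesis by (simp add: mult.commute)
qed

text \<open>The \<open>e\<close>-th power map sends the nonzero elements to \<open>d\<close>-th
  roots of unity with fibres of size at most \<open>e\<close>. The image thus has at least
  \<open>d\<close> elements, while there are at most \<open>d\<close> roots, so both bounds are
  attained.\<close>

lemma power_map_finite_field:
  fixes u :: "'a::{field,finite}"
  assumes "d * e = card (UNIV :: 'a set) - 1"
  shows "(\<lambda>x. x ^ e) ` (UNIV - {0}) = {x::'a. x ^ d = 1}" and "card {x::'a. x ^ d = 1} = d"
proof -
  have "card {0, 1::'a} \<le> card (UNIV :: 'a set)"
    by (intro card_mono) auto
  hence "d * e > 0" using assms by simp
  hence pos: "d > 0" "e > 0" by auto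
  let ?P = "(\<lambda>x::'a. x ^ e) ` (UNIV - {0})" and ?R = "{x::'a. x ^ d = 1}"
  have sub: "?P \<subseteq> ?R"
    using power_card_UNIV_minus_1[where 'a = 'a]
    by (auto simp: mult.commute[of e d] assms simp flip: power_mult)
  have "e * d = card (UNIV - {0::'a})"
    using assms by (simp add: mult.commute)
  also have "\<dots> \<le> e * card ?P"
  proof (rule card_le_card_image)
    fix y :: 'a
    have "card {x\<in>UNIV - {0}. x ^ e = y} \<le> card {x. x ^ e = y}"
      by (intro card_mono) auto
    also have "\<dots> \<le> e" using pos(2) by (rule card_power_eq_le)
    finally show "card {x\<in>UNIV - {0}. x ^ e = y} \<le> e" .
  qed auto
  finally have "d \<le> card ?P" using pos by simp
  moreover have "card ?P \<le> card ?R" by (intro card_mono sub) auto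
  moreover have "card ?R \<le> d" using pos(1) by (rule card_power_eq_le)
  ultimately have *: "card ?P = card ?R" "card ?R = d" by linarith+
  show "card ?R = d" by fact
  show "?P = ?R" using sub *(1) by (intro card_subset_eq) auto
qed

text \<open>The nonzero solutions of \<open>x ^ Q = x\<close> are the roots of unity of order
  dividing \<open>Q - 1\<close>, and zero is the remaining one.\<close>

lemma card_subfield_of_order:
  assumes "Q > 1" "(Q - 1) * e = card (UNIV :: 'a::{field,finite} set) - 1"
  shows "card (subfield_of_order Q :: 'a set) = Q"
proof -
  have "x ^ Q = x \<longleftrightarrow> x = 0 \<or> x ^ (Q - 1) = 1" for x :: 'a
  proof -
    have "x ^ Q = x ^ (Q - 1) * x" using power_minus_mult[of Q x] assms(1) by simp
    thus ?thesis by auto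
  qed
  hence "(subfield_of_order Q :: 'a set) = insert 0 {x. x ^ (Q - 1) = 1}"
    by (auto simp: subfield_of_order_def)
  thus ?thesis
    using assms power_map_finite_field(2)[OF assms(2)] by (simp add: power_0_left)
qed

lemma finite_field_power_add:
  fixes x y :: "'a::{field,finite}"
  assumes "prime p" "card (UNIV :: 'a set) = p ^ k" "Q = p ^ j"
  shows "(x + y) ^ Q = x ^ Q + y ^ Q"
proof -
  have "CHAR('a) > 0" by (rule finite_imp_CHAR_pos) simp
  hence prime: "prime CHAR('a)" by (rule prime_CHAR_semidom)
  \<comment> \<open>Translation by 1 permutes the field, so the sum of all elements absorbs
    \<open>p ^ k\<close> extra ones; hence the characteristic divides \<open>p ^ k\<close>.\<close>
  have "(\<Sum>x\<in>UNIV. x + 1) = (\<Sum>x\<in>UNIV. x :: 'a)"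
    by (rule sum.reindex_bij_witness[of _ "\<lambda>x. x - 1" "\<lambda>x. x + 1"]) auto
  hence "of_nat (p ^ k) = (0::'a)"
    unfolding sum.distrib by (simp add: assms(2))
  hence "CHAR('a) dvd p ^ k" by (simp only: of_nat_eq_0_iff_char_dvd)
  with prime assms(1) have char: "CHAR('a) = p"
    by (metis prime_dvd_power primes_dvd_imp_eq)
  show "(x + y) ^ Q = x ^ Q + y ^ Q"
    by (rule freshmans_dream'[OF prime, of _ j]) (simp add: assms(3) char)
qed

lemma power_eq_1_iff_mult_ord_dvd:
  fixes x :: "'a::{field,finite}"
  assumes "x \<noteq> 0"
  shows "x ^ k = 1 \<longleftrightarrow> mult_ord x dvd k"
proof -
  have "card {0, 1::'a} \<le> card (UNIV :: 'a set)"
    by (intro card_mono) auto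
  \<comment> \<open>The order is a \<open>LEAST\<close>, so some positive exponent must be exhibited
    first; the size of the multiplicative group serves.\<close>
  hence "\<exists>k. 0 < k \<and> x ^ k = 1"
    using power_card_UNIV_minus_1[OF assms] by (intro exI[of _ "card (UNIV :: 'a set) - 1"]) auto
  hence ord: "0 < mult_ord x" "x ^ mult_ord x = 1"
    unfolding mult_ord_def by (metis (mono_tags, lifting) LeastI)+
  have least: "mult_ord x \<le> j" if "0 < j" "x ^ j = 1" for j
    unfolding mult_ord_def using that by (intro Least_le) auto
  have "x ^ k = x ^ (mult_ord x * (k div mult_ord x) + k mod mult_ord x)"
    by simp
  also have "\<dots> = x ^ (k mod mult_ord x)"
    unfolding power_add power_mult by (simp add: ord)
  finally have "x ^ k = 1 \<longleftrightarrow> x ^ (k mod mult_ord x) = 1" by simp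
  also have "\<dots> \<longleftrightarrow> k mod mult_ord x = 0"
    using least[of "k mod mult_ord x"] mod_less_divisor[OF ord(1), of k]
    by (metis gr0I leD power_0)
  finally show ?thesis by (simp add: mod_eq_0_iff_dvd)
qed

subsection \<open>Complements of inversive planes\<close>

text \<open>Double counting of the pairs of a point outside \<open>S\<close> and a block through
  \<open>S\<close> and that point.\<close>

lemma sum_card_blocks_insert:
  assumes "finite V" "finite B" "\<And>b. b \<in> B \<Longrightarrow> b \<subseteq> V \<and> card b = k" "S \<subseteq> V"
  shows "(\<Sum>i\<in>V - S. card {b\<in>B. insert i S \<subseteq> b}) = (k - card S) * card {b\<in>B. S \<subseteq> b}"
proof -
  have "(\<Sum>i\<in>V - S. card {b\<in>{b\<in>B. S \<subseteq> b}. i \<in> b}) = (k - card S) * card {b\<in>B. S \<subseteq> b}"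
  proof (rule sum_multicount, goal_cases)
    case 3
    show ?case
    proof
      fix b assume b: "b \<in> {b\<in>B. S \<subseteq> b}"
      hence "{i\<in>V - S. i \<in> b} = b - S" using assms(3) by blast
      moreover have "finite S" using assms(1,4) by (rule finite_subset[rotated])
      ultimately show "card {i\<in>V - S. i \<in> b} = k - card S"
        using b assms(3)[of b] by (simp add: card_Diff_subset)
    qed
  qed (use assms(1,2) in auto)
  moreover have "{b\<in>{b\<in>B. S \<subseteq> b}. i \<in> b} = {b\<in>B. insert i S \<subseteq> b}" for i by blast
  ultimately show ?thesis by simp
qed

text \<open>A block either contains \<open>i\<close> or avoids it. Iterated over three points this
  becomes inclusion-exclusion.\<close>

lemma card_blocks_avoiding_insert:
  assumes "finite B"
  shows "card {b\<in>B. S \<subseteq> b \<and> T \<inter> b = {}} =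
    card {b\<in>B. insert i S \<subseteq> b \<and> T \<inter> b = {}} + card {b\<in>B. S \<subseteq> b \<and> insert i T \<inter> b = {}}"
proof -
  let ?X = "{b\<in>B. insert i S \<subseteq> b \<and> T \<inter> b = {}}"
  let ?Y = "{b\<in>B. S \<subseteq> b \<and> insert i T \<inter> b = {}}"
  have "{b\<in>B. S \<subseteq> b \<and> T \<inter> b = {}} = ?X \<union> ?Y"
    by auto
  moreover have "card (?X \<union> ?Y) = card ?X + card ?Y"
    using assms by (intro card_Un_disjoint) auto
  ultimately show ?thesis by (simp only:)
qed

context
  fixes q :: nat and B :: "nat set set"
  assumes q: "q > 1" and design: "is_t_design 3 (q\<^sup>2 + 1) (q + 1) 1 B"
begin

lemma inversive_plane_finite: "finite B"
proof (rule finite_subset)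
  show "B \<subseteq> Pow {..<q\<^sup>2 + 1}" using design unfolding is_t_design_def by blast
qed simp

text \<open>If the number of blocks through one more point is a constant, double counting determines
  the number through \<open>S\<close>. Descending from three points to none gives all block counts
  of an inversive plane.\<close>

lemma inversive_plane_step:
  assumes "S \<subseteq> {..<q\<^sup>2 + 1}"
    and "\<And>i. i < q\<^sup>2 + 1 \<Longrightarrow> i \<notin> S \<Longrightarrow> card {b\<in>B. insert i S \<subseteq> b} = \<mu>"
  shows "(q + 1 - card S) * card {b\<in>B. S \<subseteq> b} = (q\<^sup>2 + 1 - card S) * \<mu>"
proof -
  have "finite S" using assms(1) finite_subset by blast
  have "(q + 1 - card S) * card {b\<in>B. S \<subseteq> b}
      = (\<Sum>i\<in>{..<q\<^sup>2 + 1} - S. card {b\<in>B. insert i S \<subseteq> b})"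
    using assms(1) design inversive_plane_finite
    by (intro sum_card_blocks_insert[symmetric]) (auto simp: is_t_design_def)
  also have "\<dots> = (\<Sum>i\<in>{..<q\<^sup>2 + 1} - S. \<mu>)"
    by (intro sum.cong refl assms(2)) auto
  also have "\<dots> = (q\<^sup>2 + 1 - card S) * \<mu>"
    using assms(1) \<open>finite S\<close> by (simp add: card_Diff_subset)
  finally show ?thesis .
qed

lemma inversive_plane_3:
  assumes "i < q\<^sup>2 + 1" "j < q\<^sup>2 + 1" "k < q\<^sup>2 + 1" "i \<noteq> j" "i \<noteq> k" "j \<noteq> k"
  shows "card {b\<in>B. {i, j, k} \<subseteq> b} = 1"
proof -
  have "{i, j, k} \<subseteq> {..<q\<^sup>2 + 1} \<and> card {i, j, k} = 3" using assms by simp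
  thus ?thesis using design unfolding is_t_design_def by blast
qed

lemma inversive_plane_2:
  assumes "i < q\<^sup>2 + 1" "j < q\<^sup>2 + 1" "i \<noteq> j"
  shows "card {b\<in>B. {i, j} \<subseteq> b} = q + 1"
proof -
  have "(q + 1 - card {i, j}) * card {b\<in>B. {i, j} \<subseteq> b} = (q\<^sup>2 + 1 - card {i, j}) * 1"
    using assms by (intro inversive_plane_step inversive_plane_3) auto
  also have "\<dots> = (q - 1) * (q + 1)"
    using assms by (simp add: algebra_simps power2_eq_square diff_mult_distrib)
  finally have "(q - 1) * card {b\<in>B. {i, j} \<subseteq> b} = (q - 1) * (q + 1)"
    using assms by simp
  thus ?thesis using q by (subst (asm) mult_cancel1) simp
qed

lemma inversive_plane_1:
  assumes "i < q\<^sup>2 + 1"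
  shows "card {b\<in>B. {i} \<subseteq> b} = q * (q + 1)"
proof -
  have "(q + 1 - card {i}) * card {b\<in>B. {i} \<subseteq> b} = (q\<^sup>2 + 1 - card {i}) * (q + 1)"
  proof (rule inversive_plane_step)
    fix j assume "j < q\<^sup>2 + 1" "j \<notin> {i}"
    thus "card {b\<in>B. {j, i} \<subseteq> b} = q + 1" using assms by (intro inversive_plane_2) auto
  qed (use assms in auto)
  hence "q * card {b\<in>B. {i} \<subseteq> b} = q * (q * (q + 1))"
    by (simp add: power2_eq_square algebra_simps)
  thus ?thesis using q by (subst (asm) mult_cancel1) simp
qed

lemma inversive_plane_0: "card B = q * (q\<^sup>2 + 1)"
proof -
  have "(q + 1 - card ({} :: nat set)) * card {b\<in>B. {} \<subseteq> b} = (q\<^sup>2 + 1 - card ({} :: nat set)) * (q * (q + 1))"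
    by (rule inversive_plane_step) (use inversive_plane_1 in auto)
  hence "(q + 1) * card B = (q + 1) * (q * (q\<^sup>2 + 1))"
    by (simp add: algebra_simps)
  thus ?thesis by (subst (asm) mult_cancel1) simp
qed

text \<open>Inclusion-exclusion over the points of \<open>T\<close> gives
  \<open>q (q^2 + 1) - 3 q (q + 1) + 3 (q + 1) - 1\<close>, which factors as claimed.\<close>

lemma inversive_plane_avoid:
  assumes "T \<subseteq> {..<q\<^sup>2 + 1}" "card T = 3"
  shows "card {b\<in>B. T \<inter> b = {}} = (q\<^sup>2 - q - 1) * (q - 2)"
proof -
  obtain i j k where T: "T = {i, j, k}" "i \<noteq> j" "i \<noteq> k" "j \<noteq> k"
    using assms(2) by (auto simp: card_3_iff)
  hence lt: "i < q\<^sup>2 + 1" "j < q\<^sup>2 + 1" "k < q\<^sup>2 + 1" using assms(1) by auto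
  define \<mu> where "\<mu> S T = card {b\<in>B. S \<subseteq> b \<and> T \<inter> b = {}}" for S T :: "nat set"
  have step: "\<mu> S T = \<mu> (insert i S) T + \<mu> S (insert i T)" for S T i
    unfolding \<mu>_def by (rule card_blocks_avoiding_insert[OF inversive_plane_finite])
  have \<mu>_alt: "\<mu> S {} = card {b\<in>B. S \<subseteq> b}" for S
    by (simp add: \<mu>_def)
  have \<mu>: "\<mu> {} {} = q * (q\<^sup>2 + 1)"
    "\<mu> {i} {} = q * (q + 1)" "\<mu> {j} {} = q * (q + 1)" "\<mu> {k} {} = q * (q + 1)"
    "\<mu> {i, j} {} = q + 1" "\<mu> {i, k} {} = q + 1" "\<mu> {j, k} {} = q + 1" "\<mu> {i, j, k} {} = 1"
    unfolding \<mu>_alt using T(2-) lt inversive_plane_0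
    by (simp_all only: inversive_plane_1 inversive_plane_2 inversive_plane_3 empty_subsetI simp_thms Collect_mem_eq)
  have "int (\<mu> {} {k, j, i}) = int (\<mu> {} {}) - int (\<mu> {i} {}) - (int (\<mu> {j} {}) - int (\<mu> {i, j} {}))
      - (int (\<mu> {k} {}) - int (\<mu> {i, k} {}) - (int (\<mu> {j, k} {}) - int (\<mu> {i, j, k} {})))"
    using step[of "{}" "{}" i] step[of "{}" "{i}" j] step[of "{j}" "{}" i]
      step[of "{}" "{j, i}" k] step[of "{k}" "{i}" j] step[of "{k}" "{}" i] step[of "{j, k}" "{}" i]
    by linarith
  also have "\<dots> = (int q ^ 2 - int q - 1) * (int q - 2)"
    unfolding \<mu> by (simp add: algebra_simps power2_eq_square)
  also have "\<dots> = int ((q\<^sup>2 - q - 1) * (q - 2))"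
  proof -
    \<comment> \<open>This keeps the natural-number subtraction \<open>q\<^sup>2 - q - 1\<close>
      from truncating, so it agrees with the one over the integers.\<close>
    have "q * 2 \<le> q * q" using q by (intro mult_left_mono) auto
    hence "q + 1 \<le> q\<^sup>2" using q unfolding power2_eq_square by linarith
    thus ?thesis using q by (simp add: of_nat_diff)
  qed
  finally have "\<mu> {} {k, j, i} = (q\<^sup>2 - q - 1) * (q - 2)" by (simp only: of_nat_eq_iff)
  moreover have "T = {k, j, i}" using T by auto
  ultimately show ?thesis by (simp add: \<mu>_def)
qed

text \<open>The complement of a block contains \<open>T\<close> exactly when the block avoids
  \<open>T\<close>, and complementation is injective.\<close>

lemma inversive_plane_complement:
  "is_t_design 3 (q\<^sup>2 + 1) (q\<^sup>2 - q) ((q\<^sup>2 - q - 1) * (q - 2)) ((\<lambda>b. {..<q\<^sup>2 + 1} - b) ` B)"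
  unfolding is_t_design_def
proof (intro conjI allI impI ballI)
  fix b assume "b \<in> (\<lambda>b. {..<q\<^sup>2 + 1} - b) ` B"
  then obtain a where a: "b = {..<q\<^sup>2 + 1} - a" "a \<subseteq> {..<q\<^sup>2 + 1}" "card a = q + 1"
    using design by (auto simp: is_t_design_def)
  moreover have "finite a" using a(2) finite_subset by blast
  ultimately show "b \<subseteq> {..<q\<^sup>2 + 1}" "card b = q\<^sup>2 - q"
    by (simp_all add: card_Diff_subset)
next
  fix T assume T: "T \<subseteq> {..<q\<^sup>2 + 1} \<and> card T = 3"
  hence "{b \<in> (\<lambda>b. {..<q\<^sup>2 + 1} - b) ` B. T \<subseteq> b} = (\<lambda>b. {..<q\<^sup>2 + 1} - b) ` {b\<in>B. T \<inter> b = {}}"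
    by blast
  hence "card {b \<in> (\<lambda>b. {..<q\<^sup>2 + 1} - b) ` B. T \<subseteq> b} =
      card ((\<lambda>b. {..<q\<^sup>2 + 1} - b) ` {b\<in>B. T \<inter> b = {}})"
    by (rule arg_cong)
  also have "\<dots> = card {b\<in>B. T \<inter> b = {}}"
  proof (intro card_image inj_onI)
    fix a b
    assume "a \<in> {b\<in>B. T \<inter> b = {}}" "b \<in> {b\<in>B. T \<inter> b = {}}" "{..<q\<^sup>2 + 1} - a = {..<q\<^sup>2 + 1} - b"
    moreover from this have "a \<subseteq> {..<q\<^sup>2 + 1}" "b \<subseteq> {..<q\<^sup>2 + 1}"
      using design by (auto simp: is_t_design_def)
    ultimately show "a = b" by blast
  qed
  also have "\<dots> = (q\<^sup>2 - q - 1) * (q - 2)"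
    using T by (intro inversive_plane_avoid) auto
  finally show "card {b \<in> (\<lambda>b. {..<q\<^sup>2 + 1} - b) ` B. T \<subseteq> b} = (q\<^sup>2 - q - 1) * (q - 2)" .
qed

end

section \<open>Words with prescribed support, and binomial identities\<close>

definition words_on :: "'a::field set \<Rightarrow> nat set \<Rightarrow> 'a poly set" where
  "words_on F S = {c. (\<forall>i. coeff c i \<in> F) \<and> supp c \<subseteq> S}"

lemma words_conv_words_on: "words F n = words_on F {..<n}"
  unfolding words_def words_on_def supp_def by (auto intro: not_le_imp_less)

lemma card_words_on:
  assumes "finite S" "0 \<in> F"
  shows "card (words_on F S) = card F ^ card S"
proof -
  define \<phi> :: "'a poly \<Rightarrow> nat \<Rightarrow> 'a" where "\<phi> c = restrict (coeff c) S" for c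
  have "bij_betw \<phi> (words_on F S) (PiE S (\<lambda>_. F))"
  proof (rule bij_betwI')
    fix c d assume cd: "c \<in> words_on F S" "d \<in> words_on F S"
    show "\<phi> c = \<phi> d \<longleftrightarrow> c = d"
    proof
      assume eq: "\<phi> c = \<phi> d"
      show "c = d"
      proof (rule poly_eqI)
        fix i
        show "coeff c i = coeff d i"
        proof (cases "i \<in> S")
          case True
          thus ?thesis using fun_cong[OF eq, of i] by (simp add: \<phi>_def)
        next
          case False
          hence "coeff c i = 0" "coeff d i = 0" using cd by (auto simp: words_on_def supp_def)
          thus ?thesis by simp
        qed
      qed
    qed simp
  next
    fix c assume "c \<in> words_on F S"
    thus "\<phi> c \<in> PiE S (\<lambda>_. F)" by (auto simp: \<phi>_def words_on_def)
  next
    fix f assume f: "f \<in> PiE S (\<lambda>_. F)"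
    define c where "c = (\<Sum>i\<in>S. monom (f i) i)"
    have c: "coeff c i = (if i \<in> S then f i else 0)" for i
      using assms(1) by (auto simp: c_def coeff_sum)
    have "c \<in> words_on F S"
      using f assms(2) by (auto simp: words_on_def supp_def c)
    moreover have "f = \<phi> c"
      using f by (auto simp: \<phi>_def c fun_eq_iff PiE_def extensional_def)
    ultimately show "\<exists>c\<in>words_on F S. f = \<phi> c" by blast
  qed
  hence "card (words_on F S) = card (PiE S (\<lambda>_. F))" by (rule bij_betw_same_card)
  thus ?thesis using assms(1) by (simp add: card_PiE)
qed

text \<open>Division-free forms of the small binomial coefficients carry over to the integers in
  \<open>num_values\<close>.\<close>

lemma choose_two': "2 * (n choose 2) = n * (n - 1)"
  by (cases "even n") (auto simp: choose_two)

lemma choose_three: "6 * (n choose 3) = n * (n - 1) * (n - 2)"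
proof (induction n)
  case (Suc n)
  have "Suc n choose 3 = (n choose 2) + (n choose 3)"
    by (simp add: numeral_3_eq_3 numeral_2_eq_2)
  hence "6 * (Suc n choose 3) = 3 * (n * (n - 1)) + n * (n - 1) * (n - 2)"
    using Suc choose_two'[of n] by linarith
  also have "\<dots> = Suc n * (Suc n - 1) * (Suc n - 2)"
    by (cases n; cases "n - 1") (auto simp: algebra_simps)
  finally show ?case .
qed simp

subsection \<open>Codes whose zero sets are circles\<close>

text \<open>All weights, designs and dual parameters follow from these assumptions alone. In
  \<open>circle\<close> the set \<open>Z\<close> depends only on \<open>T\<close>; that nonzero
  words vanishing on \<open>T\<close> exist is not assumed but comes from counting.\<close>

locale circle_code =
  fixes F :: "'a::field set" and C :: "'a poly set" and q n :: nat
  assumes one_closed: "1 \<in> F"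
    and diff_closed: "x \<in> F \<Longrightarrow> y \<in> F \<Longrightarrow> x - y \<in> F"
    and mult_closed: "x \<in> F \<Longrightarrow> y \<in> F \<Longrightarrow> x * y \<in> F"
    and inverse_closed: "x \<in> F \<Longrightarrow> inverse x \<in> F"
    and card_F: "card F = q\<^sup>2"
    and q: "q > 2" and n: "n = q\<^sup>2 + 1"
    and words: "C \<subseteq> words F n"
    and code_diff: "c \<in> C \<Longrightarrow> d \<in> C \<Longrightarrow> c - d \<in> C"
    and code_smult: "x \<in> F \<Longrightarrow> c \<in> C \<Longrightarrow> smult x c \<in> C"
    and card_C: "card C = card F ^ 4"
    and circle: "T \<subseteq> {..<n} \<Longrightarrow> card T = 3 \<Longrightarrow> \<exists>Z\<subseteq>{..<n}. card Z = q + 1 \<and>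
      (\<forall>c\<in>C. c \<noteq> 0 \<longrightarrow> (\<forall>i\<in>T. coeff c i = 0) \<longrightarrow> {i. i < n \<and> coeff c i = 0} = Z)"
begin

definition zeros :: "'a poly \<Rightarrow> nat set" where
  "zeros c = {i. i < n \<and> coeff c i = 0}"

definition vanish :: "nat set \<Rightarrow> 'a poly set" where
  "vanish T = {c\<in>C. \<forall>i\<in>T. coeff c i = 0}"

definition circles :: "nat set set" where
  "circles = zeros ` {c\<in>C. c \<noteq> 0 \<and> card (zeros c) = q + 1}"

lemma card_F_gt_1: "card F > 1"
proof -
  have "1 * 1 < q * q" using q by (intro mult_strict_mono) auto
  thus ?thesis by (simp add: card_F power2_eq_square)
qed

lemma finite_F: "finite F"
  using card_F_gt_1 by (intro card_ge_0_finite) simp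

lemma finite_C: "finite C"
  using card_C card_F_gt_1 by (intro card_ge_0_finite) simp

lemma zero_closed: "0 \<in> F"
  using diff_closed[OF one_closed one_closed] by simp

lemma uminus_closed: "x \<in> F \<Longrightarrow> - x \<in> F"
  using diff_closed[OF zero_closed] by simp

lemma add_closed: "x \<in> F \<Longrightarrow> y \<in> F \<Longrightarrow> x + y \<in> F"
  using diff_closed[OF _ uminus_closed, of x y] by simp

lemma sum_closed: "(\<And>i. i \<in> A \<Longrightarrow> f i \<in> F) \<Longrightarrow> sum f A \<in> F"
  by (induction A rule: infinite_finite_induct) (auto simp: zero_closed add_closed)

lemma zero_code: "0 \<in> C"
proof -
  have "C \<noteq> {}" using card_C card_F_gt_1 by auto
  then obtain c where "c \<in> C" by blast
  thus ?thesis using code_diff[of c c] by simp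
qed

lemma code_add: "c \<in> C \<Longrightarrow> d \<in> C \<Longrightarrow> c + d \<in> C"
  using code_diff[OF _ code_diff[OF zero_code], of c d] by simp

lemma code_sum: "(\<And>i. i \<in> A \<Longrightarrow> f i \<in> C) \<Longrightarrow> sum f A \<in> C"
  by (induction A rule: infinite_finite_induct) (auto simp: zero_code code_add)

lemma coeff_closed: "c \<in> C \<Longrightarrow> coeff c i \<in> F"
  using words by (auto simp: words_def)

lemma zero_vanish: "0 \<in> vanish T"
  by (simp add: vanish_def zero_code)

lemma finite_vanish: "finite (vanish T)"
  using finite_C by (simp add: vanish_def)

lemma vanish_empty: "vanish {} = C"
  by (simp add: vanish_def)

lemma supp_conv_zeros:
  assumes "c \<in> words F n"
  shows "supp c = {..<n} - zeros c"
  using assms by (auto simp: supp_def zeros_def words_def intro: not_le_imp_less)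

lemma zeros_subset: "zeros c \<subseteq> {..<n}"
  by (auto simp: zeros_def)

lemma finite_zeros: "finite (zeros c)"
  using zeros_subset finite_subset by blast

lemma hwt_conv_zeros:
  assumes "c \<in> words F n"
  shows "hwt c = n - card (zeros c)"
  using zeros_subset[of c] finite_zeros[of c]
  by (simp add: hwt_def supp_conv_zeros[OF assms] card_Diff_subset)

text \<open>Evaluation at \<open>i\<close> is additive on \<open>vanish T\<close>, has kernel
  \<open>vanish (insert i T)\<close> and takes at most \<open>card F\<close> values.\<close>

lemma card_vanish_insert: "card (vanish T) \<le> card F * card (vanish (insert i T))"
proof -
  have "card (vanish T) \<le> card (vanish (insert i T)) * card ((\<lambda>c. coeff c i) ` vanish T)"
  proof (rule card_le_card_image[OF finite_vanish])
    fix y assume "y \<in> (\<lambda>c. coeff c i) ` vanish T"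
    then obtain d where d: "d \<in> vanish T" "coeff d i = y" by blast
    show "card {c \<in> vanish T. coeff c i = y} \<le> card (vanish (insert i T))"
    proof (rule card_inj_on_le[OF _ _ finite_vanish])
      show "inj_on (\<lambda>c. c - d) {c \<in> vanish T. coeff c i = y}" by (simp add: inj_on_def)
      show "(\<lambda>c. c - d) ` {c \<in> vanish T. coeff c i = y} \<subseteq> vanish (insert i T)"
        using d by (auto simp: vanish_def code_diff)
    qed
  qed
  also have "\<dots> \<le> card (vanish (insert i T)) * card F"
    by (intro mult_left_mono card_mono finite_F) (auto simp: vanish_def coeff_closed)
  finally show ?thesis by (simp add: mult.commute)
qed

lemma card_vanish_Un:
  assumes "finite S"
  shows "card (vanish T) \<le> card F ^ card S * card (vanish (S \<union> T))"
  using assms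
proof (induction S)
  case (insert i S)
  have "card F ^ card S * card (vanish (S \<union> T)) \<le>
      card F ^ card S * (card F * card (vanish (insert i (S \<union> T))))"
    by (intro mult_left_mono card_vanish_insert) auto
  with insert.IH have "card (vanish T) \<le>
      card F ^ card S * (card F * card (vanish (insert i (S \<union> T))))"
    by (rule order_trans)
  thus ?case using insert.hyps by (simp add: mult_ac)
qed simp

lemma n_ge: "n \<ge> 10"
  using mult_mono[of 3 q 3 q] q by (simp add: n power2_eq_square)

text \<open>Nonzero words vanishing on \<open>T\<close> share one zero set of \<open>q + 1\<close>
  coordinates. Together with \<open>T\<close> it cannot cover all \<open>n\<close> coordinates, and
  a further zero at an uncovered one forces the word to be 0.\<close>

lemma vanish_4:
  assumes "T \<subseteq> {..<n}" "card T = 3"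
  obtains l where "l < n" "l \<notin> T" "vanish (insert l T) = {0}"
proof -
  obtain Z where Z: "Z \<subseteq> {..<n}" "card Z = q + 1"
    and eq: "\<And>c. c \<in> C \<Longrightarrow> c \<noteq> 0 \<Longrightarrow> \<forall>i\<in>T. coeff c i = 0 \<Longrightarrow> zeros c = Z"
    using circle[OF assms] unfolding zeros_def by blast
  have "finite Z" using Z finite_subset by blast
  have fin: "finite T" using assms(1) finite_subset by blast
  have "card (Z \<union> T) \<le> q + 4" using card_Un_le[of Z T] assms(2) Z(2) by simp
  moreover have "3 * q \<le> q * q" using q by (intro mult_right_mono) auto
  hence "q + 4 < q * q + 1" using q by linarith
  ultimately have "card (Z \<union> T) < card {..<n}" by (simp add: n power2_eq_square)
  hence "\<not> {..<n} \<subseteq> Z \<union> T"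
    using card_mono[of "Z \<union> T" "{..<n}"] \<open>finite Z\<close> fin by auto
  then obtain l where l: "l < n" "l \<notin> Z" "l \<notin> T" by auto
  have "c = 0" if "c \<in> vanish (insert l T)" for c
    using eq[of c] that l by (auto simp: vanish_def zeros_def)
  hence "vanish (insert l T) = {0}" using zero_vanish by blast
  thus ?thesis using l that by blast
qed

text \<open>Each new coordinate divides the size by at most \<open>card F\<close>. Four suitable
  coordinates containing \<open>T\<close> lead from \<open>card F ^ 4\<close> words down to one, so
  every step must lose exactly one factor.\<close>

lemma card_vanish:
  assumes "T \<subseteq> {..<n}" "card T \<le> 3"
  shows "card (vanish T) = card F ^ (4 - card T)"
proof -
  have "3 \<le> card {..<n}" using n_ge by simp
  then obtain T' where T': "T \<subseteq> T'" "T' \<subseteq> {..<n}" "card T' = 3"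
    using exists_subset_between[of T 3 "{..<n}"] assms by auto
  then obtain l where l: "l < n" "l \<notin> T'" "vanish (insert l T') = {0}"
    using vanish_4 by blast
  have fin: "finite T'" "finite T" using T' assms(1) finite_subset by blast+
  have "card (vanish T) \<le> card F ^ card (insert l T' - T) * card (vanish ((insert l T' - T) \<union> T))"
    using fin by (intro card_vanish_Un) auto
  moreover have "(insert l T' - T) \<union> T = insert l T'" using T' by blast
  moreover have "card (insert l T' - T) = 4 - card T"
    using T' l fin by (subst card_Diff_subset) auto
  ultimately have upper: "card (vanish T) \<le> card F ^ (4 - card T)" using l by simp
  have "card F ^ 4 \<le> card F ^ card T * card (vanish T)"
    using card_vanish_Un[of T "{}"] fin by (simp add: vanish_empty card_C)
  also have "card F ^ 4 = card F ^ card T * card F ^ (4 - card T)"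
    using assms(2) by (simp flip: power_add)
  finally have "card F ^ (4 - card T) \<le> card (vanish T)"
    using card_F_gt_1 by simp
  with upper show ?thesis by simp
qed

text \<open>By \<open>card_vanish\<close> some nonzero word vanishes on \<open>T\<close>, so the set
  supplied by \<open>circle\<close> really is a circle, and it contains \<open>T\<close>.\<close>

lemma circle_cases:
  assumes "T \<subseteq> {..<n}" "card T = 3"
  obtains Z where "Z \<in> circles" "T \<subseteq> Z"
    "\<And>c. c \<in> vanish T \<Longrightarrow> c \<noteq> 0 \<Longrightarrow> zeros c = Z"
    "\<And>Z'. Z' \<in> circles \<Longrightarrow> T \<subseteq> Z' \<Longrightarrow> Z' = Z"
proof -
  obtain Z where Z: "Z \<subseteq> {..<n}" "card Z = q + 1"
    and eq: "\<And>c. c \<in> vanish T \<Longrightarrow> c \<noteq> 0 \<Longrightarrow> zeros c = Z"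
    using circle[OF assms] unfolding zeros_def vanish_def by blast
  have "card (vanish T) > 1"
    using card_vanish[OF assms(1)] assms(2) card_F_gt_1 by simp
  hence "\<not> vanish T \<subseteq> {0}" using card_mono[of "{0}" "vanish T"] by fastforce
  then obtain c where c: "c \<in> vanish T" "c \<noteq> 0" by blast
  show ?thesis
  proof (rule that)
    show "Z \<in> circles"
      using c eq[OF c] Z unfolding circles_def by (auto simp: vanish_def)
    show "T \<subseteq> Z"
      using c(1) assms(1) unfolding eq[OF c, symmetric] by (auto simp: vanish_def zeros_def)
    fix Z' assume "Z' \<in> circles" "T \<subseteq> Z'"
    then obtain d where d: "d \<in> C" "d \<noteq> 0" "Z' = zeros d" by (auto simp: circles_def)
    moreover from this \<open>T \<subseteq> Z'\<close> have "d \<in> vanish T" by (auto simp: vanish_def zeros_def)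
    ultimately show "Z' = Z" using eq by blast
  qed (use eq in auto)
qed

lemma circles_subset: "Z \<in> circles \<Longrightarrow> Z \<subseteq> {..<n} \<and> card Z = q + 1"
  using zeros_subset by (auto simp: circles_def)

lemma circles_design: "is_t_design 3 (q\<^sup>2 + 1) (q + 1) 1 circles"
  unfolding is_t_design_def n[symmetric]
proof (intro conjI ballI allI impI)
  fix T assume T: "T \<subseteq> {..<n} \<and> card T = 3"
  then obtain Z where "Z \<in> circles" "T \<subseteq> Z" "\<And>Z'. Z' \<in> circles \<Longrightarrow> T \<subseteq> Z' \<Longrightarrow> Z' = Z"
    using circle_cases by metis
  hence "{b \<in> circles. T \<subseteq> b} = {Z}" by blast
  thus "card {b \<in> circles. T \<subseteq> b} = 1" by simp
qed (use circles_subset in auto)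

text \<open>Three zeros already force a whole circle of zeros.\<close>

lemma card_zeros_cases:
  assumes "c \<in> C" "c \<noteq> 0"
  shows "card (zeros c) \<in> {0, 1, 2, q + 1}"
proof (cases "card (zeros c) \<ge> 3")
  case True
  then obtain T where T: "T \<subseteq> zeros c" "card T = 3"
    using obtain_subset_with_card_n by metis
  have "T \<subseteq> {..<n}" using T(1) zeros_subset by blast
  then obtain Z where "Z \<in> circles" "\<And>c. c \<in> vanish T \<Longrightarrow> c \<noteq> 0 \<Longrightarrow> zeros c = Z"
    using circle_cases T(2) by metis
  moreover have "c \<in> vanish T" using T(1) assms by (auto simp: vanish_def zeros_def)
  ultimately show ?thesis using circles_subset assms by auto
qed auto

section \<open>Weight distribution from binomial moments\<close>

definition num :: "nat \<Rightarrow> nat" where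
  "num j = card {c\<in>C - {0}. card (zeros c) = j}"

text \<open>The codomain is left general because the sum is used both for binomial coefficients and
  for monomials of the weight enumerator.\<close>

lemma sum_zeros:
  fixes f :: "nat \<Rightarrow> 'b::semiring_1"
  shows "(\<Sum>c\<in>C - {0}. f (card (zeros c))) =
    of_nat (num 0) * f 0 + of_nat (num 1) * f 1 + of_nat (num 2) * f 2 + of_nat (num (q + 1)) * f (q + 1)"
proof -
  have sub: "(\<lambda>c. card (zeros c)) ` (C - {0}) \<subseteq> {0, 1, 2, q + 1}"
    by (rule image_subsetI, rule card_zeros_cases) auto
  have "(\<Sum>c\<in>C - {0}. f (card (zeros c))) = (\<Sum>j\<in>{0, 1, 2, q + 1}. of_nat (num j) * f j)"
    unfolding num_def using finite_C by (intro sum_fun_comp[OF _ _ sub, of f]) auto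
  also have "\<dots> = of_nat (num 0) * f 0 + of_nat (num 1) * f 1 + of_nat (num 2) * f 2 + of_nat (num (q + 1)) * f (q + 1)"
    using q by (simp add: add.assoc)
  finally show ?thesis .
qed

text \<open>Double counting of pairs of a nonzero word and a \<open>k\<close>-subset of its zeros;
  \<open>card_vanish\<close> gives the same number of words for each subset.\<close>

lemma sum_choose_zeros:
  assumes "k \<le> 3"
  shows "(\<Sum>c\<in>C - {0}. card (zeros c) choose k) = (card F ^ (4 - k) - 1) * (n choose k)"
proof -
  let ?T = "{T. T \<subseteq> {..<n} \<and> card T = k}"
  have "(\<Sum>c\<in>C - {0}. card {T\<in>?T. T \<subseteq> zeros c}) = (card F ^ (4 - k) - 1) * card ?T"
  proof (rule sum_multicount, goal_cases)
    case 3
    show ?case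
    proof
      fix T assume T: "T \<in> ?T"
      hence "{c\<in>C - {0}. T \<subseteq> zeros c} = vanish T - {0}"
        by (auto simp: vanish_def zeros_def)
      thus "card {c\<in>C - {0}. T \<subseteq> zeros c} = card F ^ (4 - k) - 1"
        using card_vanish[of T] T assms zero_vanish[of T] finite_vanish[of T]
        by (simp add: card_Diff_singleton)
    qed
  qed (use finite_C in auto)
  moreover have "{T\<in>?T. T \<subseteq> zeros c} = {T. T \<subseteq> zeros c \<and> card T = k}" for c
    using zeros_subset by blast
  ultimately show ?thesis
    by (simp add: n_subsets finite_zeros)
qed

text \<open>The moments form a triangular system: \<open>k = 3\<close> sees only the words with
  \<open>q + 1\<close> zeros, and then \<open>k = 2, 1, 0\<close> each bring in one new
  unknown.\<close>

lemma num_values: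
  "int (num (q + 1)) = int q ^ 5 - int q"
  "2 * int (num 2) = (int q ^ 4 - 1) * (int q - 1) * int q ^ 3"
  "int (num 1) = int q ^ 7 - int q ^ 5 + int q ^ 4 - int q ^ 3 + int q - 1"
  "2 * int (num 0) = (int q ^ 4 - 1) * (int q - 1) * int q ^ 3"
proof -
  define Q where "Q = int q"
  have Q: "Q > 2" using q by (simp add: Q_def)
  have F: "int (card F ^ k - 1) = Q ^ (2 * k) - 1" for k
  proof -
    have "card F ^ k \<ge> 1" using card_F_gt_1 by simp
    thus ?thesis by (simp add: of_nat_diff card_F Q_def power_mult)
  qed
  \<comment> \<open>The same fact in the shape to which the simplifier rewrites
    \<open>1\<close>.\<close>
  have F: "int (card F ^ k - Suc 0) = Q ^ (2 * k) - 1" for k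
    using F[of k] by simp
  have choose: "int (num 0) * (0 choose k) + int (num 1) * (1 choose k) + int (num 2) * (2 choose k)
      + int (num (q + 1)) * (q + 1 choose k) = (Q ^ (2 * (4 - k)) - 1) * (n choose k)" if "k \<le> 3" for k
    using arg_cong[OF sum_choose_zeros[OF that], of int] sum_zeros[of "\<lambda>j. int (j choose k)"]
    by (simp add: F)
  have c2: "2 * int (m choose 2) = int m * (int m - 1)" if "m \<ge> 1" for m
    using arg_cong[OF choose_two'[of m], of int] that by (simp add: of_nat_diff)
  have c3: "6 * int (m choose 3) = int m * (int m - 1) * (int m - 2)" if "m \<ge> 2" for m
    using arg_cong[OF choose_three[of m], of int] that by (simp add: of_nat_diff)
  have n': "int n = Q ^ 2 + 1" "n \<ge> 2" using n_ge by (auto simp: n Q_def)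
  have e3: "int (num (q + 1)) * int (q + 1 choose 3) = (Q\<^sup>2 - 1) * int (n choose 3)"
    using choose[of 3] by (simp add: binomial_eq_0)
  have "6 * int (q + 1 choose 3) = (Q + 1) * Q * (Q - 1)"
    using c3[of "q + 1"] q by (simp add: Q_def)
  moreover have "6 * int (n choose 3) = (Q\<^sup>2 + 1) * Q\<^sup>2 * (Q\<^sup>2 - 1)"
    using c3[of n] n' by simp
  ultimately have "int (num (q + 1)) * ((Q + 1) * Q * (Q - 1)) = (Q\<^sup>2 - 1) * ((Q\<^sup>2 + 1) * Q\<^sup>2 * (Q\<^sup>2 - 1))"
    using e3 by algebra
  also have "\<dots> = (Q ^ 5 - Q) * ((Q + 1) * Q * (Q - 1))" by algebra
  finally have A: "int (num (q + 1)) = Q ^ 5 - Q" using Q by simp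
  show "int (num (q + 1)) = int q ^ 5 - int q" using A by (simp add: Q_def)
  have q2: "2 * int (q + 1 choose 2) = (Q + 1) * Q"
    using c2[of "q + 1"] by (simp add: Q_def)
  have n2: "2 * int (n choose 2) = (Q\<^sup>2 + 1) * Q\<^sup>2"
    using c2[of n] n' by simp
  have "int (num 2) + int (num (q + 1)) * int (q + 1 choose 2) = (Q ^ 4 - 1) * int (n choose 2)"
    using choose[of 2] by (simp add: binomial_eq_0)
  hence B: "2 * int (num 2) = (Q ^ 4 - 1) * (Q - 1) * Q ^ 3"
    using A q2 n2 by algebra
  thus "2 * int (num 2) = (int q ^ 4 - 1) * (int q - 1) * int q ^ 3" by (simp add: Q_def)
  have "int (num 1) + 2 * int (num 2) + int (num (q + 1)) * (Q + 1) = (Q ^ 6 - 1) * (Q\<^sup>2 + 1)"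
    using choose[of 1] n' by (simp add: Q_def mult.commute add_ac)
  hence D: "int (num 1) = Q ^ 7 - Q ^ 5 + Q ^ 4 - Q ^ 3 + Q - 1"
    using A B by algebra
  thus "int (num 1) = int q ^ 7 - int q ^ 5 + int q ^ 4 - int q ^ 3 + int q - 1" by (simp add: Q_def)
  have E: "int (num 0) + int (num 1) + int (num 2) + int (num (q + 1)) = Q ^ 8 - 1"
    using choose[of 0] by simp
  have "2 * int (num 0) = 2 * (int (num 0) + int (num 1) + int (num 2) + int (num (q + 1)))
      - 2 * int (num 1) - 2 * int (num 2) - 2 * int (num (q + 1))"
    by simp
  also have "\<dots> = 2 * (Q ^ 8 - 1) - 2 * (Q ^ 7 - Q ^ 5 + Q ^ 4 - Q ^ 3 + Q - 1)
      - (Q ^ 4 - 1) * (Q - 1) * Q ^ 3 - 2 * (Q ^ 5 - Q)"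
    unfolding E unfolding A B D by (rule refl)
  also have "\<dots> = (Q ^ 4 - 1) * (Q - 1) * Q ^ 3" by algebra
  finally have "2 * int (num 0) = (Q ^ 4 - 1) * (Q - 1) * Q ^ 3" .
  thus "2 * int (num 0) = (int q ^ 4 - 1) * (int q - 1) * int q ^ 3" by (simp add: Q_def)
qed

lemma weight_enumerator_code:
  "weight_enumerator C =
      1 + monom (int q ^ 5 - int q) (q^2 - q)
        + monom ((int q ^ 4 - 1) * (int q - 1) * int q ^ 3 div 2) (q^2 - 1)
        + monom ((int q ^ 4 - 1) * (int q - 1) * int q ^ 3 div 2) (q^2 + 1)
        + monom (int q ^ 7 - int q ^ 5 + int q ^ 4 - int q ^ 3 + int q - 1) (q^2)"
proof -
  have mon: "of_nat k * monom (1::int) j = monom (int k) j" for k j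
    by (simp add: of_nat_monom mult_monom)
  have "weight_enumerator C = monom 1 (hwt (0::'a poly)) + (\<Sum>c\<in>C - {0}. monom 1 (hwt c))"
    unfolding weight_enumerator_def using finite_C zero_code by (simp add: sum.remove)
  also have "monom 1 (hwt (0::'a poly)) = (1 :: int poly)"
    by (simp add: hwt_def supp_def)
  also have "(\<Sum>c\<in>C - {0}. monom 1 (hwt c)) = (\<Sum>c\<in>C - {0}. monom (1::int) (n - card (zeros c)))"
    using words by (intro sum.cong refl) (auto simp: hwt_conv_zeros)
  also have "\<dots> = monom (int (num 0)) (q\<^sup>2 + 1) + monom (int (num 1)) (q\<^sup>2)
      + monom (int (num 2)) (q\<^sup>2 - 1) + monom (int (num (q + 1))) (q\<^sup>2 - q)"
    unfolding sum_zeros[of "\<lambda>j. monom (1::int) (n - j)"] by (simp add: mon n)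
  finally have we: "weight_enumerator C = 1 + (monom (int (num 0)) (q\<^sup>2 + 1) + monom (int (num 1)) (q\<^sup>2)
      + monom (int (num 2)) (q\<^sup>2 - 1) + monom (int (num (q + 1))) (q\<^sup>2 - q))" .
  \<comment> \<open>The divisions by 2 in the enumerator are exact, since the numerators are twice
    integer counts.\<close>
  have half: "x = y div 2" if "2 * x = y" for x y :: int
    using that by simp
  show ?thesis
    unfolding we num_values(1,3) half[OF num_values(2)] half[OF num_values(4)]
    by (simp only: add_ac)
qed

section \<open>Minimum weight words and their supports\<close>

lemma circles_nonempty: "circles \<noteq> {}"
proof -
  have "card {..<3::nat} = 3" "{..<3} \<subseteq> {..<n}"
    using n_ge by auto
  thus ?thesis using circle_cases by (metis empty_iff)
qed

lemma min_dist_code: "min_dist C = q\<^sup>2 - q"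
  unfolding min_dist_def
proof (rule Min_eqI)
  obtain c where "c \<in> C" "c \<noteq> 0" "card (zeros c) = q + 1"
    using circles_nonempty by (auto simp: circles_def)
  moreover from this have "hwt c = q\<^sup>2 - q" using words by (subst hwt_conv_zeros) (auto simp: n)
  ultimately show "q\<^sup>2 - q \<in> hwt ` (C - {0})" by force
  fix w assume "w \<in> hwt ` (C - {0})"
  then obtain c where "c \<in> C" "c \<noteq> 0" "w = hwt c" by blast
  moreover from this have "card (zeros c) \<le> q + 1" using card_zeros_cases[of c] q by auto
  ultimately show "w \<ge> q\<^sup>2 - q" using words hwt_conv_zeros[of c] n by auto
qed (use finite_C in auto)

lemma min_weight_supports_code: "min_weight_supports C = (\<lambda>Z. {..<q\<^sup>2 + 1} - Z) ` circles"
proof -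
  have q': "q \<le> q\<^sup>2" by (simp add: power2_eq_square)
  have "hwt c = q\<^sup>2 - q \<longleftrightarrow> card (zeros c) = q + 1" if "c \<in> C" "c \<noteq> 0" for c
    using card_zeros_cases[OF that] hwt_conv_zeros[of c] words that q q' n by auto
  hence "min_weight_supports C = supp ` {c\<in>C. c \<noteq> 0 \<and> card (zeros c) = q + 1}"
    unfolding min_weight_supports_def min_dist_code by blast
  also have "\<dots> = (\<lambda>Z. {..<q\<^sup>2 + 1} - Z) ` circles"
    unfolding circles_def image_image using words supp_conv_zeros n by (intro image_cong) auto
  finally show ?thesis .
qed

end

subsection \<open>The dual code\<close>

context circle_code
begin

text \<open>This says that the coordinates in \<open>T\<close> are linearly independent functionals
  on the code, witnessed by unit words. Sets smaller than a full information set are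
  allowed.\<close>

definition info_set :: "nat set \<Rightarrow> bool" where
  "info_set T \<longleftrightarrow> T \<subseteq> {..<n} \<and>
     (\<forall>i\<in>T. \<exists>e\<in>C. coeff e i = 1 \<and> (\<forall>j\<in>T - {i}. coeff e j = 0))"

text \<open>A strict drop in size at \<open>i\<close> yields a word vanishing on the rest of
  \<open>T\<close> but not at \<open>i\<close>; scaling it gives the unit word.\<close>

lemma info_setI:
  assumes "T \<subseteq> {..<n}" "\<And>i. i \<in> T \<Longrightarrow> card (vanish T) < card (vanish (T - {i}))"
  shows "info_set T"
  unfolding info_set_def
proof (intro conjI ballI)
  fix i assume i: "i \<in> T"
  have "\<not> vanish (T - {i}) \<subseteq> vanish T"
    using assms(2)[OF i] card_mono[OF finite_vanish, of "vanish (T - {i})" T] by linarith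
  then obtain c where c: "c \<in> vanish (T - {i})" "c \<notin> vanish T" by blast
  define e where "e = smult (inverse (coeff c i)) c"
  have "coeff c i \<noteq> 0" using c i by (auto simp: vanish_def)
  hence "coeff e i = 1" by (simp add: e_def)
  moreover have "e \<in> C"
    using c by (auto simp: e_def vanish_def intro!: code_smult inverse_closed coeff_closed)
  moreover have "\<forall>j\<in>T - {i}. coeff e j = 0" using c by (auto simp: e_def vanish_def)
  ultimately show "\<exists>e\<in>C. coeff e i = 1 \<and> (\<forall>j\<in>T - {i}. coeff e j = 0)" by blast
qed (use assms in auto)

lemma info_set_3:
  assumes "T \<subseteq> {..<n}" "card T = 3"
  shows "info_set T"
proof (rule info_setI[OF assms(1)])
  fix i assume i: "i \<in> T"
  have "card (T - {i}) = 2" using assms i by (simp add: card_Diff_singleton)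
  moreover have "T - {i} \<subseteq> {..<n}" using assms(1) by blast
  ultimately have "card (vanish (T - {i})) = card F ^ 2" using card_vanish[of "T - {i}"] by simp
  moreover have "card (vanish T) = card F ^ 1" using card_vanish[of T] assms by simp
  moreover have "card F ^ 1 < card F ^ 2" using card_F_gt_1 by (intro power_strict_increasing) auto
  ultimately show "card (vanish T) < card (vanish (T - {i}))" by simp
qed

lemma info_set_4:
  assumes "T \<subseteq> {..<n}" "card T = 4" "vanish T = {0}"
  shows "info_set T"
proof (rule info_setI[OF assms(1)])
  fix i assume i: "i \<in> T"
  have "card (T - {i}) = 3" using assms i by (simp add: card_Diff_singleton)
  moreover have "T - {i} \<subseteq> {..<n}" using assms(1) by blast
  ultimately have "card (vanish (T - {i})) = card F" using card_vanish[of "T - {i}"] by simp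
  thus "card (vanish T) < card (vanish (T - {i}))" using assms(3) card_F_gt_1 by simp
qed

definition ip :: "'a poly \<Rightarrow> 'a poly \<Rightarrow> 'a" where
  "ip v c = (\<Sum>i<n. coeff v i * coeff c i)"

lemma ip_diff_left: "ip (v - w) c = ip v c - ip w c"
  by (simp add: ip_def left_diff_distrib sum_subtractf)

lemma ip_add_right: "ip v (c + d) = ip v c + ip v d"
  by (simp add: ip_def distrib_left sum.distrib)

lemma ip_smult_right: "ip v (smult x c) = x * ip v c"
  by (simp add: ip_def sum_distrib_left mult_ac)

lemma ip_sum_right: "ip v (sum f A) = (\<Sum>i\<in>A. ip v (f i))"
  by (simp add: ip_def coeff_sum sum_distrib_left sum.swap[of _ A])

lemma dual_code_ip: "dual_code F n C = {v \<in> words F n. \<forall>c\<in>C. ip v c = 0}"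
  by (simp add: dual_code_def ip_def)

lemma finite_dual: "finite (dual_code F n C)"
proof (rule finite_subset)
  have "card (words F n) > 0"
    using card_F_gt_1 zero_closed by (simp add: words_conv_words_on card_words_on)
  thus "finite (words F n)" by (rule card_ge_0_finite)
qed (auto simp: dual_code_def)

lemma dual_supp_subset: "v \<in> dual_code F n C \<Longrightarrow> supp v \<subseteq> {..<n}"
  by (simp add: dual_code_def words_conv_words_on words_on_def)

text \<open>Pairing \<open>v\<close> with the unit word at \<open>i\<close> isolates its coefficient
  at \<open>i\<close>.\<close>

lemma dual_eq_0:
  assumes "v \<in> dual_code F n C" "info_set T" "supp v \<subseteq> T"
  shows "v = 0"
proof -
  have "coeff v i = 0" if i: "i \<in> T" for i
  proof -
    obtain e where e: "e \<in> C" "coeff e i = 1" "\<forall>j\<in>T - {i}. coeff e j = 0"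
      using assms(2) i by (auto simp: info_set_def)
    have "ip v e = (\<Sum>j<n. if j = i then coeff v i else 0)"
      unfolding ip_def
    proof (intro sum.cong refl)
      fix j
      show "coeff v j * coeff e j = (if j = i then coeff v i else 0)"
        using e assms(3) by (cases "j \<in> T") (auto simp: supp_def)
    qed
    also have "\<dots> = coeff v i"
      using i assms(2) by (auto simp: info_set_def)
    finally show ?thesis using assms(1) e(1) by (simp add: dual_code_ip)
  qed
  thus ?thesis using assms(3) by (intro poly_eqI) (auto simp: supp_def)
qed

text \<open>Pairing with the \<open>card T\<close> unit words maps the words on \<open>S\<close> to
  tuples over \<open>F\<close>. Its kernel lies in the dual, because on \<open>S\<close> every
  codeword agrees with a combination of unit words. The fibre bound then yields many dual words on
  \<open>S\<close>.\<close>

lemma card_dual_supported: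
  assumes "info_set T" "S \<subseteq> {..<n}" "\<And>c j. c \<in> vanish T \<Longrightarrow> j \<in> S \<Longrightarrow> coeff c j = 0"
  shows "card F ^ card S \<le> card F ^ card T * card {v \<in> dual_code F n C. supp v \<subseteq> S}"
proof -
  have fin: "finite S" "finite T"
    using assms(1,2) finite_subset[OF _ finite_lessThan] by (auto simp: info_set_def)
  obtain e where e: "e i \<in> C" "coeff (e i) i = 1" "j \<in> T \<Longrightarrow> j \<noteq> i \<Longrightarrow> coeff (e i) j = 0"
    if "i \<in> T" for i j
  proof -
    from assms(1) have "\<forall>i\<in>T. \<exists>e. e \<in> C \<and> coeff e i = 1 \<and> (\<forall>j\<in>T - {i}. coeff e j = 0)"
      by (auto simp: info_set_def)
    then obtain e where "\<forall>i\<in>T. e i \<in> C \<and> coeff (e i) i = 1 \<and> (\<forall>j\<in>T - {i}. coeff (e i) j = 0)"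
      by (auto dest!: bchoice)
    thus ?thesis using that[of e] by blast
  qed
  define f where "f v = restrict (\<lambda>i. ip v (e i)) T" for v
  let ?W = "words_on F S"
  let ?D = "{v \<in> dual_code F n C. supp v \<subseteq> S}"
  have cardW: "card ?W = card F ^ card S"
    using fin zero_closed by (intro card_words_on)
  have finW: "finite ?W"
    using cardW card_F_gt_1 by (intro card_ge_0_finite) simp
  have W_sub: "?W \<subseteq> words F n" using assms(2) by (auto simp: words_conv_words_on words_on_def)
  have ker: "u \<in> ?D" if u: "u \<in> ?W" and 0: "\<And>i. i \<in> T \<Longrightarrow> ip u (e i) = 0" for u
  proof -
    have "ip u c = 0" if c: "c \<in> C" for c
    proof -
      \<comment> \<open>This codeword interpolates \<open>c\<close> on \<open>T\<close>, so
        \<open>c - r\<close> vanishes on \<open>T\<close> and hence on \<open>S\<close>.\<close>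
      define r where "r = (\<Sum>i\<in>T. smult (coeff c i) (e i))"
      have "coeff r j = coeff c j" if j: "j \<in> T" for j
      proof -
        have "coeff r j = (\<Sum>i\<in>T. if i = j then coeff c j else 0)"
          unfolding r_def coeff_sum using e j by (intro sum.cong) auto
        thus ?thesis using j fin by simp
      qed
      moreover have "r \<in> C"
        unfolding r_def using e c by (intro code_sum code_smult coeff_closed) auto
      ultimately have "c - r \<in> vanish T"
        using c by (simp add: vanish_def code_diff)
      hence "coeff u j * coeff (c - r) j = 0" for j
        using assms(3)[of "c - r" j] u by (cases "j \<in> S") (auto simp: words_on_def supp_def)
      hence "ip u (c - r) = 0" by (simp only: ip_def sum.neutral_const)
      moreover have "ip u r = 0" by (simp add: r_def ip_sum_right ip_smult_right 0)
      ultimately show ?thesis using ip_add_right[of u "c - r" r] by simp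
    qed
    thus ?thesis using u W_sub by (auto simp: dual_code_ip words_on_def)
  qed
  have "card ?W \<le> card ?D * card (f ` ?W)"
  proof (rule card_le_card_image[OF finW])
    fix y assume "y \<in> f ` ?W"
    then obtain d where d: "d \<in> ?W" "f d = y" by blast
    show "card {v \<in> ?W. f v = y} \<le> card ?D"
    proof (rule card_inj_on_le)
      show "inj_on (\<lambda>v. v - d) {v \<in> ?W. f v = y}" by (simp add: inj_on_def)
      show "(\<lambda>v. v - d) ` {v \<in> ?W. f v = y} \<subseteq> ?D"
      proof
        fix u assume "u \<in> (\<lambda>v. v - d) ` {v \<in> ?W. f v = y}"
        then obtain v where v: "v \<in> ?W" "f v = y" "u = v - d" by auto
        show "u \<in> ?D"
        proof (rule ker)
          have "coeff u i = 0" if "i \<notin> S" for i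
          proof -
            have "coeff v i = 0" "coeff d i = 0"
              using that v(1) d(1) by (auto simp: words_on_def supp_def)
            thus ?thesis by (simp add: v(3))
          qed
          thus "u \<in> ?W"
            using v d diff_closed by (auto simp: words_on_def supp_def)
          fix i assume "i \<in> T"
          thus "ip u (e i) = 0"
            using fun_cong[OF v(2), of i] fun_cong[OF d(2), of i] v(3) by (simp add: f_def ip_diff_left)
        qed
      qed
      show "finite ?D" using finite_dual by simp
    qed
  qed
  also have "card (f ` ?W) \<le> card (PiE T (\<lambda>_. F))"
  proof (rule card_mono)
    show "finite (PiE T (\<lambda>_. F))" using fin finite_F by (intro finite_PiE)
    show "f ` ?W \<subseteq> PiE T (\<lambda>_. F)"
      using coeff_closed[OF e(1)]
      by (auto simp: f_def ip_def words_on_def intro!: sum_closed mult_closed)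
  qed
  also have "card (PiE T (\<lambda>_. F)) = card F ^ card T"
    using fin by (simp add: card_PiE)
  finally show ?thesis by (simp add: cardW mult.commute)
qed

text \<open>Take four independent coordinates \<open>I\<close>. The lower bound is
  \<open>card_dual_supported\<close> on all coordinates; the upper bound holds because a dual word
  is determined by its entries outside \<open>I\<close>.\<close>

lemma card_dual: "card (dual_code F n C) = card F ^ (n - 4)"
proof -
  have 3: "{..<3} \<subseteq> {..<n}" "card {..<3::nat} = 3" using n_ge by auto
  obtain l where l: "l < n" "l \<notin> {..<3}" "vanish (insert l {..<3}) = {0}"
    using vanish_4[OF 3] .
  define I where "I = insert l {..<3}"
  have I: "I \<subseteq> {..<n}" "card I = 4" "vanish I = {0}" using l 3 by (auto simp: I_def)
  have info: "info_set I" using I by (rule info_set_4)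
  have fin: "finite I" using I(1) finite_subset by blast
  have "card F ^ card {..<n} \<le> card F ^ card I * card {v \<in> dual_code F n C. supp v \<subseteq> {..<n}}"
    using I(3) by (intro card_dual_supported info) auto
  also have "{v \<in> dual_code F n C. supp v \<subseteq> {..<n}} = dual_code F n C"
    using dual_supp_subset by blast
  finally have "card F ^ 4 * card F ^ (n - 4) \<le> card F ^ 4 * card (dual_code F n C)"
    using I n_ge by (simp flip: power_add)
  hence lower: "card F ^ (n - 4) \<le> card (dual_code F n C)"
    using card_F_gt_1 by simp
  define J where "J = {..<n} - I"
  have J: "finite J" "card J = n - 4" using I fin by (simp_all add: J_def card_Diff_subset)
  have "card (dual_code F n C) \<le> card (PiE J (\<lambda>_. F))"
  proof (rule card_inj_on_le)
    show "inj_on (\<lambda>v. restrict (coeff v) J) (dual_code F n C)"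
    proof (rule inj_onI)
      fix v w assume vw: "v \<in> dual_code F n C" "w \<in> dual_code F n C"
        and eq: "restrict (coeff v) J = restrict (coeff w) J"
      have "v - w \<in> dual_code F n C"
        using vw by (auto simp: dual_code_ip words_def ip_diff_left diff_closed)
      moreover have "coeff v i = coeff w i" if "i \<notin> I" for i
      proof (cases "i < n")
        case True
        thus ?thesis using fun_cong[OF eq, of i] that by (simp add: J_def)
      next
        case False
        thus ?thesis using vw by (simp add: dual_code_def words_def)
      qed
      hence "supp (v - w) \<subseteq> I" by (auto simp: supp_def)
      ultimately have "v - w = 0" using info by (intro dual_eq_0)
      thus "v = w" by simp
    qed
    show "(\<lambda>v. restrict (coeff v) J) ` dual_code F n C \<subseteq> PiE J (\<lambda>_. F)"
      by (auto simp: dual_code_def words_def)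
    show "finite (PiE J (\<lambda>_. F))" using J finite_F by (intro finite_PiE)
  qed
  also have "\<dots> = card F ^ (n - 4)" using J by (simp add: card_PiE)
  finally show ?thesis using lower by simp
qed

text \<open>Any three coordinates are independent on the code, so no nonzero dual word is supported
  on them.\<close>

lemma hwt_dual_ge:
  assumes "v \<in> dual_code F n C" "v \<noteq> 0"
  shows "hwt v \<ge> 4"
proof (rule ccontr)
  assume "\<not> hwt v \<ge> 4"
  hence "card (supp v) \<le> 3" by (simp add: hwt_def)
  moreover have "supp v \<subseteq> {..<n}" using assms(1) by (rule dual_supp_subset)
  moreover have "3 \<le> card {..<n}" using n_ge by simp
  ultimately obtain T where "supp v \<subseteq> T" "T \<subseteq> {..<n}" "card T = 3"
    using exists_subset_between[of "supp v" 3 "{..<n}"] by auto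
  thus False using dual_eq_0[OF assms(1) info_set_3[of T]] assms(2) by blast
qed

text \<open>If one coordinate of the support were off the circle through the other three, only 0
  would vanish on all four. They would then be independent and carry no nonzero dual word.\<close>

lemma dual_supp_4:
  assumes "v \<in> dual_code F n C" "v \<noteq> 0" "hwt v = 4"
  shows "\<exists>Z\<in>circles. supp v \<subseteq> Z"
proof -
  have S: "card (supp v) = 4" "supp v \<subseteq> {..<n}"
    using assms dual_supp_subset by (auto simp: hwt_def)
  then obtain l where l: "l \<in> supp v" by fastforce
  define T where "T = supp v - {l}"
  have T: "T \<subseteq> {..<n}" "card T = 3"
    using S l by (auto simp: T_def card_Diff_singleton)
  obtain Z where Z: "Z \<in> circles" "T \<subseteq> Z" "\<And>c. c \<in> vanish T \<Longrightarrow> c \<noteq> 0 \<Longrightarrow> zeros c = Z"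
    using circle_cases[OF T] by metis
  have "l \<in> Z"
  proof (rule ccontr)
    assume l': "l \<notin> Z"
    have "c = 0" if "c \<in> vanish (supp v)" for c
    proof (rule ccontr)
      assume "c \<noteq> 0"
      moreover have "c \<in> vanish T" using that by (auto simp: vanish_def T_def)
      ultimately have "zeros c = Z" using Z(3) by blast
      moreover have "l \<in> zeros c" using that l S by (auto simp: zeros_def vanish_def)
      ultimately show False using l' by simp
    qed
    hence "vanish (supp v) = {0}" using zero_vanish by blast
    hence "info_set (supp v)" using S by (intro info_set_4)
    thus False using dual_eq_0[OF assms(1), of "supp v"] assms(2) by simp
  qed
  hence "supp v \<subseteq> Z" using Z(2) by (auto simp: T_def)
  thus ?thesis using Z(1) by blast
qed

text \<open>On a circle, vanishing at three of the four coordinates forces vanishing at the fourth.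
  With \<open>card T = 3\<close> and \<open>card S = 4\<close> this leaves at least
  \<open>card F\<close> dual words on \<open>S\<close>, and minimum weight 4 makes the support all
  of \<open>S\<close>.\<close>

lemma ex_dual_supp_4:
  assumes "Z \<in> circles" "S \<subseteq> Z" "card S = 4"
  shows "\<exists>v\<in>dual_code F n C. v \<noteq> 0 \<and> supp v = S"
proof -
  have Sn: "S \<subseteq> {..<n}" using assms circles_subset by blast
  have fin: "finite S" using Sn finite_subset by blast
  obtain T where T: "T \<subseteq> S" "card T = 3"
    using obtain_subset_with_card_n[of 3 S] assms(3) by auto
  have Tn: "T \<subseteq> {..<n}" using T Sn by blast
  have van: "coeff c j = 0" if "c \<in> vanish T" "j \<in> S" for c j
  proof (cases "c = 0")
    case False
    obtain Z' where Z': "\<And>c. c \<in> vanish T \<Longrightarrow> c \<noteq> 0 \<Longrightarrow> zeros c = Z'"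
      "\<And>Z. Z \<in> circles \<Longrightarrow> T \<subseteq> Z \<Longrightarrow> Z = Z'"
      using circle_cases[OF Tn T(2)] by metis
    have "zeros c = Z" using Z'(1)[OF that(1) False] Z'(2)[OF assms(1)] T(1) assms(2) by blast
    thus ?thesis using that(2) assms(2) by (auto simp: zeros_def)
  qed simp
  have "card F ^ card S \<le> card F ^ card T * card {v \<in> dual_code F n C. supp v \<subseteq> S}"
    using Tn T(2) by (intro card_dual_supported info_set_3 Sn van)
  hence "card F ^ 3 * card F \<le> card F ^ 3 * card {v \<in> dual_code F n C. supp v \<subseteq> S}"
    by (simp add: assms(3) T(2) mult.commute flip: power_Suc)
  hence "card F \<le> card {v \<in> dual_code F n C. supp v \<subseteq> S}"
    using card_F_gt_1 by simp
  hence "\<not> {v \<in> dual_code F n C. supp v \<subseteq> S} \<subseteq> {0}"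
    using card_mono[of "{0}" "{v \<in> dual_code F n C. supp v \<subseteq> S}"] card_F_gt_1 by auto
  then obtain v where v: "v \<in> dual_code F n C" "supp v \<subseteq> S" "v \<noteq> 0" by blast
  have "supp v = S"
    using hwt_dual_ge[OF v(1,3)] fin v(2) assms(3) unfolding hwt_def
    by (intro card_seteq) auto
  thus ?thesis using v by blast
qed

lemma ex_4_subset_circle: "\<exists>Z\<in>circles. \<exists>S\<subseteq>Z. card S = 4"
proof -
  obtain Z where Z: "Z \<in> circles" using circles_nonempty by blast
  hence "4 \<le> card Z" using circles_subset q by auto
  then obtain S where "S \<subseteq> Z" "card S = 4" using obtain_subset_with_card_n by metis
  thus ?thesis using Z by blast
qed

lemma min_dist_dual: "min_dist (dual_code F n C) = 4"
  unfolding min_dist_def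
proof (rule Min_eqI)
  obtain v where "v \<in> dual_code F n C" "v \<noteq> 0" "hwt v = 4"
    using ex_4_subset_circle ex_dual_supp_4 unfolding hwt_def by metis
  thus "4 \<in> hwt ` (dual_code F n C - {0})" by force
qed (use finite_dual hwt_dual_ge in auto)

lemma min_weight_supports_dual:
  "min_weight_supports (dual_code F n C) = {S. card S = 4 \<and> (\<exists>Z\<in>circles. S \<subseteq> Z)}"
  unfolding min_weight_supports_def min_dist_dual
proof (intro equalityI subsetI)
  fix S assume "S \<in> {supp c |c. c \<in> dual_code F n C \<and> c \<noteq> 0 \<and> hwt c = 4}"
  thus "S \<in> {S. card S = 4 \<and> (\<exists>Z\<in>circles. S \<subseteq> Z)}"
    using dual_supp_4 by (auto simp: hwt_def)
next
  fix S assume "S \<in> {S. card S = 4 \<and> (\<exists>Z\<in>circles. S \<subseteq> Z)}"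
  then obtain v where "v \<in> dual_code F n C" "v \<noteq> 0" "supp v = S" "card S = 4"
    using ex_dual_supp_4 by blast
  thus "S \<in> {supp c |c. c \<in> dual_code F n C \<and> c \<noteq> 0 \<and> hwt c = 4}"
    by (auto simp: hwt_def)
qed

text \<open>A concyclic quadruple containing \<open>T\<close> is \<open>T\<close> with one of the
  \<open>q - 2\<close> other points of its unique circle.\<close>

lemma dual_design: "is_t_design 3 (q\<^sup>2 + 1) 4 (q - 2) (min_weight_supports (dual_code F n C))"
  unfolding is_t_design_def min_weight_supports_dual n[symmetric]
proof (intro conjI ballI allI impI)
  fix T assume T: "T \<subseteq> {..<n} \<and> card T = 3"
  then obtain Z where Z: "Z \<in> circles" "T \<subseteq> Z" "\<And>Z'. Z' \<in> circles \<Longrightarrow> T \<subseteq> Z' \<Longrightarrow> Z' = Z"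
    using circle_cases by metis
  have cardZ: "card Z = q + 1" "finite Z"
    using circles_subset[OF Z(1)] finite_subset by auto
  have finT: "finite T" using Z(2) cardZ finite_subset by blast
  have eq: "{S \<in> {S. card S = 4 \<and> (\<exists>Z\<in>circles. S \<subseteq> Z)}. T \<subseteq> S} = (\<lambda>l. insert l T) ` (Z - T)"
  proof (intro equalityI subsetI)
    fix S assume "S \<in> {S \<in> {S. card S = 4 \<and> (\<exists>Z\<in>circles. S \<subseteq> Z)}. T \<subseteq> S}"
    then obtain Z' where S: "card S = 4" "T \<subseteq> S" "Z' \<in> circles" "S \<subseteq> Z'" by blast
    hence "Z' = Z" using Z(3) by blast
    have "card (S - T) = 1" using S T finT by (simp add: card_Diff_subset)
    then obtain l where "S - T = {l}" by (auto simp: card_1_singleton_iff)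
    hence "S = insert l T" "l \<in> Z - T" using S \<open>Z' = Z\<close> by auto
    thus "S \<in> (\<lambda>l. insert l T) ` (Z - T)" by blast
  next
    fix S assume "S \<in> (\<lambda>l. insert l T) ` (Z - T)"
    then obtain l where l: "l \<in> Z" "l \<notin> T" "S = insert l T" by blast
    moreover from l finT T have "card S = 4" by simp
    ultimately show "S \<in> {S \<in> {S. card S = 4 \<and> (\<exists>Z\<in>circles. S \<subseteq> Z)}. T \<subseteq> S}"
      using Z(1,2) by blast
  qed
  have "card {S \<in> {S. card S = 4 \<and> (\<exists>Z\<in>circles. S \<subseteq> Z)}. T \<subseteq> S} = card ((\<lambda>l. insert l T) ` (Z - T))"
    by (simp only: eq)
  also have "\<dots> = card (Z - T)"
    by (intro card_image) (auto simp: inj_on_def)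
  also have "\<dots> = q - 2"
    using T Z(2) cardZ finT by (simp add: card_Diff_subset)
  finally show "card {S \<in> {S. card S = 4 \<and> (\<exists>Z\<in>circles. S \<subseteq> Z)}. T \<subseteq> S} = q - 2" .
qed (use circles_subset in auto)

lemma code_dims: "code_dim F C = 4" "code_dim F (dual_code F n C) = q\<^sup>2 - 3"
  unfolding code_dim_def card_C card_dual
  using card_F_gt_1 n by (auto intro!: the_equality)

end

subsection \<open>Codes with a split check polynomial\<close>

lemma prod_roots_dvd:
  fixes X :: "'a::field poly"
  assumes "finite R" "\<And>\<rho>. \<rho> \<in> R \<Longrightarrow> poly X \<rho> = 0"
  shows "(\<Prod>\<rho>\<in>R. [:-\<rho>, 1:]) dvd X"
  using assms
proof (induction R)
  case (insert \<rho> R)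
  then obtain k where k: "X = (\<Prod>\<rho>\<in>R. [:-\<rho>, 1:]) * k" by (auto elim: dvdE)
  have "poly (\<Prod>\<rho>\<in>R. [:-\<rho>, 1:]) \<rho> \<noteq> 0"
    using insert.hyps by (auto simp: poly_prod)
  moreover have "poly X \<rho> = 0" using insert.prems by simp
  ultimately have "poly k \<rho> = 0" by (simp add: k)
  hence "[:-\<rho>, 1:] dvd k" by (simp add: poly_eq_0_iff_dvd)
  hence "[:-\<rho>, 1:] * (\<Prod>\<rho>\<in>R. [:-\<rho>, 1:]) dvd k * (\<Prod>\<rho>\<in>R. [:-\<rho>, 1:])"
    by (rule mult_dvd_mono) simp
  thus ?case using insert.hyps by (simp add: k mult.commute)
qed simp

lemma degree_prod_roots:
  fixes R :: "'a::field set"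
  shows "degree (\<Prod>\<rho>\<in>R. [:-\<rho>, 1:]) = card R"
  by (subst degree_prod_eq_sum_degree) auto

text \<open>Lagrange interpolation at \<open>R\<close>: both sides agree at \<open>card R\<close>
  points and have smaller degree.\<close>

lemma lagrange_basis_expansion:
  fixes s :: "'a::field poly"
  assumes "finite R" "degree s < card R"
  shows "\<exists>b. s = (\<Sum>\<rho>\<in>R. smult (b \<rho>) (\<Prod>\<sigma>\<in>R - {\<rho>}. [:-\<sigma>, 1:]))"
proof -
  define L where "L \<rho> = (\<Prod>\<sigma>\<in>R - {\<rho>}. [:-\<sigma>, 1:])" for \<rho>
  have L: "poly (L \<rho>) \<rho> \<noteq> 0" "\<sigma> \<in> R \<Longrightarrow> \<sigma> \<noteq> \<rho> \<Longrightarrow> poly (L \<rho>) \<sigma> = 0" for \<rho> \<sigma>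
    using assms(1) by (auto simp: L_def poly_prod)
  define b where "b \<rho> = poly s \<rho> / poly (L \<rho>) \<rho>" for \<rho>
  have "s = (\<Sum>\<rho>\<in>R. smult (b \<rho>) (L \<rho>))"
  proof (rule poly_eqI_degree[of R])
    fix \<sigma> assume \<sigma>: "\<sigma> \<in> R"
    have "poly (\<Sum>\<rho>\<in>R. smult (b \<rho>) (L \<rho>)) \<sigma> = (\<Sum>\<rho>\<in>R. if \<rho> = \<sigma> then poly s \<sigma> else 0)"
      unfolding poly_sum using L \<sigma> by (intro sum.cong) (auto simp: b_def)
    thus "poly s \<sigma> = poly (\<Sum>\<rho>\<in>R. smult (b \<rho>) (L \<rho>)) \<sigma>"
      using \<sigma> assms(1) by simp
  next
    have "degree (\<Sum>\<rho>\<in>R. smult (b \<rho>) (L \<rho>)) \<le> card R - 1"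
    proof (rule degree_sum_le[OF assms(1)])
      fix \<rho> assume "\<rho> \<in> R"
      thus "degree (smult (b \<rho>) (L \<rho>)) \<le> card R - 1"
        using degree_smult_le[of "b \<rho>" "L \<rho>"]
        by (simp add: L_def degree_prod_roots card_Diff_singleton)
    qed
    thus "degree (\<Sum>\<rho>\<in>R. smult (b \<rho>) (L \<rho>)) < card R" using assms(2) by linarith
  qed fact
  thus ?thesis unfolding L_def by blast
qed

text \<open>With \<open>h\<close> the check polynomial, the coefficients of \<open>g * (h div (x - \<rho>)) = (x\<^sup>n - \<lambda>) div (x - \<rho>)\<close>
  form a geometric progression of ratio \<open>1 / \<rho>\<close>.\<close>
lemma coeff_check_poly_code:
  fixes g s :: "'a::field poly"
  assumes "finite R" "0 \<notin> R" "degree s < card R"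
    and "g * (\<Prod>\<rho>\<in>R. [:-\<rho>, 1:]) = monom 1 n - [:lam:]"
  shows "\<exists>a. \<forall>i<n. coeff (g * s) i = (\<Sum>\<rho>\<in>R. a \<rho> * (1 / \<rho>) ^ i)"
proof -
  define L where "L \<rho> = (\<Prod>\<sigma>\<in>R - {\<rho>}. [:-\<sigma>, 1:])" for \<rho>
  obtain b where b: "s = (\<Sum>\<rho>\<in>R. smult (b \<rho>) (L \<rho>))"
    unfolding L_def using lagrange_basis_expansion[OF assms(1,3)] by blast
  have P: "coeff (g * L \<rho>) i = coeff (g * L \<rho>) 0 * (1 / \<rho>) ^ i" if \<rho>: "\<rho> \<in> R" and "i < n" for \<rho> i
    using \<open>i < n\<close>
  proof (induction i)
    case (Suc i)
    have "[:-\<rho>, 1:] * (g * L \<rho>) = monom 1 n - [:lam:]"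
      using assms(1,4) \<rho> by (simp add: L_def prod.remove[of R \<rho>] mult_ac)
    \<comment> \<open>The coefficients of \<open>monom 1 n - [:lam:]\<close> strictly between 0 and
      \<open>n\<close> vanish, which gives the recurrence of the progression.\<close>
    hence "coeff ([:-\<rho>, 1:] * (g * L \<rho>)) (Suc i) = 0"
      using Suc.prems by simp
    hence "coeff (g * L \<rho>) i = \<rho> * coeff (g * L \<rho>) (Suc i)" by simp
    hence *: "\<rho> * coeff (g * L \<rho>) (Suc i) = coeff (g * L \<rho>) 0 * (1 / \<rho>) ^ i"
      using Suc by simp
    have "\<rho> \<noteq> 0" using assms(2) \<rho> by auto
    hence "coeff (g * L \<rho>) (Suc i) = (1 / \<rho>) * (\<rho> * coeff (g * L \<rho>) (Suc i))" by simp
    thus ?case unfolding * by (simp only: power_Suc mult_ac)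
  qed simp
  have "coeff (g * s) i = (\<Sum>\<rho>\<in>R. (b \<rho> * coeff (g * L \<rho>) 0) * (1 / \<rho>) ^ i)" if "i < n" for i
  proof -
    have "coeff (g * s) i = (\<Sum>\<rho>\<in>R. b \<rho> * coeff (g * L \<rho>) i)"
      by (simp add: b sum_distrib_left coeff_sum)
    also have "\<dots> = (\<Sum>\<rho>\<in>R. (b \<rho> * coeff (g * L \<rho>) 0) * (1 / \<rho>) ^ i)"
    proof (rule sum.cong[OF refl])
      fix \<rho> assume "\<rho> \<in> R"
      from P[OF this that] show "b \<rho> * coeff (g * L \<rho>) i = (b \<rho> * coeff (g * L \<rho>) 0) * (1 / \<rho>) ^ i"
        by (simp only: mult.assoc)
    qed
    finally show ?thesis .
  qed
  thus ?thesis by (intro exI[of _ "\<lambda>\<rho>. b \<rho> * coeff (g * L \<rho>) 0"] allI impI)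
qed

subsection \<open>The coordinates as points of the projective line\<close>

locale constacyclic_setting =
  fixes p m q n r :: nat and lam \<delta> :: "'a::{field,finite}"
  assumes p: "prime p" and q: "q = p ^ m" "q > 2" and n: "n = q\<^sup>2 + 1"
    and card_UNIV: "card (UNIV :: 'a set) = q ^ 4"
    and lam: "lam \<noteq> 0" "mult_ord lam = r"
    and r: "r dvd q + 1" "multiplicity (2::nat) r = multiplicity (2::nat) (q + 1)"
    and \<delta>: "mult_ord \<delta> = r * n" "\<delta> ^ n = lam"
begin

abbreviation F :: "'a set" where "F \<equiv> subfield_of_order (q\<^sup>2)"

lemma F_iff: "x \<in> F \<longleftrightarrow> x ^ q\<^sup>2 = x"
  by (simp add: subfield_of_order_def)

lemma power_q_add: "(x + y :: 'a) ^ q = x ^ q + y ^ q"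
  by (rule finite_field_power_add[OF p _ q(1), of "m * 4"]) (simp add: card_UNIV q(1) power_mult)

lemma power_q_minus: "(- x :: 'a) ^ q = - (x ^ q)"
  using power_q_add[of x "- x"] q(2) by (simp add: power_0_left add_eq_0_iff)

lemma power_q_diff: "(x - y :: 'a) ^ q = x ^ q - y ^ q"
  using power_q_add[of x "- y"] by (simp add: power_q_minus)

lemma power_q2: "(x :: 'a) ^ q\<^sup>2 = (x ^ q) ^ q"
  by (simp add: power2_eq_square power_mult)

lemma power_q3: "(x :: 'a) ^ q ^ 3 = ((x ^ q) ^ q) ^ q"
  by (simp add: power3_eq_cube power_mult)

lemma power_q4: "(x :: 'a) ^ q ^ 4 = x"
proof (cases "x = 0")
  case False
  have "x ^ q ^ 4 = x ^ Suc (q ^ 4 - 1)" using q(2) by simp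
  also have "\<dots> = x" using power_card_UNIV_minus_1[OF False] by (simp add: card_UNIV)
  finally show ?thesis .
qed (use q(2) in \<open>simp add: power_0_left\<close>)

lemma power_q_4: "((((x :: 'a) ^ q) ^ q) ^ q) ^ q = x"
  using power_q4[of x] by (simp add: power4_eq_xxxx power_mult)

lemma F_iff': "x \<in> F \<longleftrightarrow> (x ^ q) ^ q = x"
  by (simp add: F_iff power_q2)

lemma F_closed:
  "1 \<in> F" "0 \<in> F" "x \<in> F \<Longrightarrow> y \<in> F \<Longrightarrow> x - y \<in> F" "x \<in> F \<Longrightarrow> y \<in> F \<Longrightarrow> x + y \<in> F"
  "x \<in> F \<Longrightarrow> y \<in> F \<Longrightarrow> x * y \<in> F" "x \<in> F \<Longrightarrow> inverse x \<in> F" "x \<in> F \<Longrightarrow> y \<in> F \<Longrightarrow> x / y \<in> F"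
  "x \<in> F \<Longrightarrow> - x \<in> F"
  using q(2) by (simp_all add: F_iff' power_q_diff power_q_add power_q_minus power_mult_distrib
      power_inverse       power_divide power_0_left)

lemma nat_power_identities:
  "(q - 1) * ((q + 1) * n) = q ^ 4 - 1" "(q\<^sup>2 - 1) * n = q ^ 4 - 1" "q\<^sup>2 - 1 = (q - 1) * (q + 1)"
proof -
  obtain k where k: "q = Suc k" using q(2) by (cases q) auto
  show "(q - 1) * ((q + 1) * n) = q ^ 4 - 1" "(q\<^sup>2 - 1) * n = q ^ 4 - 1" "q\<^sup>2 - 1 = (q - 1) * (q + 1)"
    by (simp_all add: n k power2_eq_square power4_eq_xxxx algebra_simps)
qed

lemma card_F: "card F = q\<^sup>2"
proof (rule card_subfield_of_order)
  show "q\<^sup>2 > 1" using q(2) by (intro one_less_power) auto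
  show "(q\<^sup>2 - 1) * n = card (UNIV :: 'a set) - 1"
    by (simp only: card_UNIV nat_power_identities(2))
qed

lemma card_Fq: "card (subfield_of_order q :: 'a set) = q"
proof (rule card_subfield_of_order)
  show "q > 1" using q(2) by simp
  show "(q - 1) * ((q + 1) * n) = card (UNIV :: 'a set) - 1"
    by (simp only: card_UNIV nat_power_identities(1))
qed

lemma Fq_subset: "subfield_of_order q \<subseteq> F"
  by (auto simp: subfield_of_order_def power_q2)

lemma \<delta>_nonzero: "\<delta> \<noteq> 0"
  using lam(1) \<delta>(2) n by (auto simp: power_0_left)

lemma \<delta>_power_eq_1: "\<delta> ^ k = 1 \<longleftrightarrow> r * n dvd k"
  using power_eq_1_iff_mult_ord_dvd[OF \<delta>_nonzero] \<delta>(1) by simp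

text \<open>As \<open>n = (q - 1) * (q + 1) + 2\<close>, common divisors of \<open>n\<close> and
  \<open>q + 1\<close> divide 2. The valuation condition makes the cofactor \<open>s\<close> of
  \<open>r\<close> in \<open>q + 1\<close> odd, hence coprime to \<open>n\<close>, so it can be
  cancelled.\<close>

lemma n_dvd_of_order:
  assumes "r * n dvd k * (q + 1)"
  shows "n dvd k"
proof -
  obtain s where s: "q + 1 = r * s" using r(1) by blast
  have "r \<noteq> 0" "s \<noteq> 0" using s by (auto intro: ccontr)
  hence "multiplicity (2::nat) (r * s) = multiplicity 2 r + multiplicity 2 s"
    by (intro prime_elem_multiplicity_mult_distrib) auto
  hence "multiplicity 2 s = 0" using r(2) s by simp
  hence odd: "odd s" using \<open>s \<noteq> 0\<close> by (simp add: multiplicity_eq_zero_iff)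
  have "coprime n s"
  proof (rule coprimeI)
    fix d assume d: "d dvd n" "d dvd s"
    have "n = (q - 1) * (q + 1) + 2"
      using q(2) by (cases q) (auto simp: n power2_eq_square algebra_simps)
    moreover have "d dvd (q - 1) * (q + 1)" using d(2) s by simp
    ultimately have "d dvd 2" using d(1) by (metis dvd_add_right_iff)
    moreover have "odd d" using d(2) odd dvd_trans by blast
    ultimately show "is_unit d"
      by (metis dvd_refl prime_nat_iff two_is_prime_nat nat_dvd_1_iff_1)
  qed
  moreover have "r * n dvd r * (k * s)" using assms unfolding s by (simp only: mult_ac)
  hence "n dvd k * s" using \<open>r \<noteq> 0\<close> by simp
  ultimately show ?thesis by (simp add: coprime_dvd_mult_left_iff)
qed

text \<open>The powers \<open>\<omega>\<^sup>i\<close>, \<open>i < n\<close>, represent the one-dimensional subspaces of the field over \<open>F\<close>, and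
  \<open>idx\<close> is the coordinate belonging to a nonzero vector.\<close>
definition \<omega> :: 'a where "\<omega> = (SOME w. w \<noteq> 0 \<and> w ^ (q - 1) = 1 / \<delta>)"

text \<open>Since \<open>r\<close> divides \<open>q + 1\<close>, the element
  \<open>1 / \<delta>\<close> is a root of unity of order dividing \<open>(q + 1) * n\<close>, and
  those are exactly the nonzero \<open>(q - 1)\<close>-th powers.\<close>

lemma \<omega>: "\<omega> \<noteq> 0" "\<omega> ^ (q - 1) = 1 / \<delta>"
proof -
  have "(q + 1) * n * (q - 1) = card (UNIV :: 'a set) - 1"
    using nat_power_identities(1) by (simp add: card_UNIV mult_ac)
  from power_map_finite_field(1)[OF this]
  have img: "(\<lambda>x. x ^ (q - 1)) ` (UNIV - {0}) = {x :: 'a. x ^ ((q + 1) * n) = 1}" .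
  have "\<delta> ^ ((q + 1) * n) = 1"
    unfolding \<delta>_power_eq_1 using r(1) by (rule mult_dvd_mono) simp
  hence "1 / \<delta> \<in> {x. x ^ ((q + 1) * n) = 1}" by (simp add: power_one_over)
  hence "\<exists>w. w \<noteq> 0 \<and> w ^ (q - 1) = 1 / \<delta>" unfolding img[symmetric] by force
  hence "\<omega> \<noteq> 0 \<and> \<omega> ^ (q - 1) = 1 / \<delta>" unfolding \<omega>_def by (rule someI_ex)
  thus "\<omega> \<noteq> 0" "\<omega> ^ (q - 1) = 1 / \<delta>" by auto
qed

lemma F_power: "t \<in> F \<Longrightarrow> t \<noteq> 0 \<Longrightarrow> t ^ (q\<^sup>2 - 1) = 1"
  using power_minus_mult[of "q\<^sup>2" t] q(2) by (simp add: F_iff)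

text \<open>Raising to the power \<open>q\<^sup>2 - 1\<close> removes the scalars from
  \<open>F\<close> and turns \<open>\<omega> ^ i\<close> into a power of \<open>1 / \<delta>\<close>
  with exponent \<open>(q + 1) * i\<close>. By \<open>n_dvd_of_order\<close> this determines
  \<open>i\<close> modulo \<open>n\<close>.\<close>

lemma \<omega>_inj:
  assumes "t \<in> F" "t' \<in> F" "t \<noteq> 0" "t' \<noteq> 0" "i < n" "j < n" "t * \<omega> ^ i = t' * \<omega> ^ j"
  shows "i = j"
  using assms
proof (induction i j arbitrary: t t' rule: linorder_wlog)
  case (le i j)
  have pow: "(s * \<omega> ^ k) ^ (q\<^sup>2 - 1) = (1 / \<delta>) ^ ((q + 1) * k)" if "s \<in> F" "s \<noteq> 0" for s k
  proof -
    have "(s * \<omega> ^ k) ^ (q\<^sup>2 - 1) = (\<omega> ^ k) ^ (q\<^sup>2 - 1)"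
      unfolding power_mult_distrib F_power[OF that] by simp
    also have "\<dots> = (\<omega> ^ (q - 1)) ^ ((q + 1) * k)"
      unfolding nat_power_identities(3) by (simp only: power_mult[symmetric] mult_ac)
    finally show ?thesis by (simp only: \<omega>)
  qed
  have "(1 / \<delta>) ^ ((q + 1) * i) = (1 / \<delta>) ^ ((q + 1) * j)"
    using pow[OF le.prems(1,3), of i] pow[OF le.prems(2,4), of j] le.prems(7) by simp
  hence "\<delta> ^ ((q + 1) * j) = \<delta> ^ ((q + 1) * i)"
    using \<delta>_nonzero by (simp add: field_simps)
  moreover have "(q + 1) * j = (q + 1) * i + (j - i) * (q + 1)"
    using le.hyps by (metis add_mult_distrib2 le_add_diff_inverse mult.commute)
  hence "\<delta> ^ ((q + 1) * j) = \<delta> ^ ((q + 1) * i) * \<delta> ^ ((j - i) * (q + 1))"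
    by (simp only: power_add)
  ultimately have "\<delta> ^ ((j - i) * (q + 1)) = 1" using \<delta>_nonzero by simp
  hence "n dvd j - i" using n_dvd_of_order by (simp only: \<delta>_power_eq_1)
  thus ?case using le.prems(6) le.hyps dvd_imp_le[of n "j - i"] by linarith
next
  case (sym i j)
  show ?case using sym.IH[OF sym.prems(2,1,4,3,6,5) sym.prems(7)[symmetric]] by simp
qed

text \<open>The pairs \<open>(t, i)\<close> number \<open>(q\<^sup>2 - 1) * n = q ^ 4 - 1\<close>,
  as many as the nonzero elements, so injectivity suffices.\<close>

lemma \<omega>_surj:
  assumes "w \<noteq> 0"
  obtains t i where "t \<in> F" "t \<noteq> 0" "i < n" "w = t * \<omega> ^ i"
proof -
  let ?f = "\<lambda>(t, i). t * \<omega> ^ i" and ?D = "(F - {0}) \<times> {..<n}"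
  have "inj_on ?f ?D"
  proof (rule inj_onI)
    fix x y assume "x \<in> ?D" "y \<in> ?D" "?f x = ?f y"
    moreover obtain t i t' j where "x = (t, i)" "y = (t', j)" by fastforce
    ultimately show "x = y" using \<omega>_inj[of t t' i j] \<omega>(1) by auto
  qed
  hence "card (?f ` ?D) = card ?D" by (rule card_image)
  also have "\<dots> = (q\<^sup>2 - 1) * n"
    using F_closed(2) by (simp add: card_cartesian_product card_F)
  also have "\<dots> = card (UNIV - {0 :: 'a})"
    unfolding nat_power_identities(2) by (simp add: card_UNIV)
  finally have "?f ` ?D = UNIV - {0}" using \<omega>(1) by (intro card_subset_eq) auto
  hence "w \<in> ?f ` ?D" using assms by blast
  thus ?thesis using that by auto
qed

definition idx :: "'a \<Rightarrow> nat" where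
  "idx w = (SOME i. i < n \<and> (\<exists>t\<in>F. t \<noteq> 0 \<and> w = t * \<omega> ^ i))"

lemma idx:
  assumes "w \<noteq> 0"
  shows "idx w < n" "\<exists>t\<in>F. t \<noteq> 0 \<and> w = t * \<omega> ^ idx w"
proof -
  have "\<exists>i. i < n \<and> (\<exists>t\<in>F. t \<noteq> 0 \<and> w = t * \<omega> ^ i)"
    using \<omega>_surj[OF assms] by metis
  hence "idx w < n \<and> (\<exists>t\<in>F. t \<noteq> 0 \<and> w = t * \<omega> ^ idx w)"
    unfolding idx_def by (rule someI_ex)
  thus "idx w < n" "\<exists>t\<in>F. t \<noteq> 0 \<and> w = t * \<omega> ^ idx w" by auto
qed

lemma idx_unique:
  assumes "t \<in> F" "t \<noteq> 0" "i < n"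
  shows "idx (t * \<omega> ^ i) = i"
proof -
  have nz: "t * \<omega> ^ i \<noteq> 0" using assms \<omega>(1) by simp
  obtain s where "s \<in> F" "s \<noteq> 0" "t * \<omega> ^ i = s * \<omega> ^ idx (t * \<omega> ^ i)"
    using idx(2)[OF nz] by blast
  thus ?thesis using \<omega>_inj[of s t "idx (t * \<omega> ^ i)" i] idx(1)[OF nz] assms by auto
qed

lemma idx_scale:
  assumes "w \<noteq> 0" "s \<in> F" "s \<noteq> 0"
  shows "idx (s * w) = idx w"
proof -
  obtain t where t: "t \<in> F" "t \<noteq> 0" "w = t * \<omega> ^ idx w" using idx(2)[OF assms(1)] by blast
  have "idx ((s * t) * \<omega> ^ idx w) = idx w"
    using assms t idx(1)[OF assms(1)] by (intro idx_unique F_closed) auto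
  thus ?thesis using t(3) by (simp add: mult.assoc)
qed

lemma idx_eqD:
  assumes "idx v = idx w" "v \<noteq> 0" "w \<noteq> 0"
  shows "\<exists>s\<in>F. s \<noteq> 0 \<and> v = s * w"
proof -
  obtain t where t: "t \<in> F" "t \<noteq> 0" "v = t * \<omega> ^ idx v" using idx(2)[OF assms(2)] by blast
  obtain u where u: "u \<in> F" "u \<noteq> 0" "w = u * \<omega> ^ idx w" using idx(2)[OF assms(3)] by blast
  have "v = (t / u) * w"
    by (subst t(3), subst u(3)) (simp add: assms(1) u(2))
  moreover have "t / u \<in> F" "t / u \<noteq> 0" using t u F_closed by auto
  ultimately show ?thesis by blast
qed

end

context constacyclic_setting
begin

subsection \<open>Zeros of sesquilinear forms\<close>

text \<open>The exponents on \<open>v\<close> are 1 and \<open>q^2\<close>, those on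
  \<open>w\<close> are \<open>q\<close> and \<open>q^3\<close>, which makes it linear in
  \<open>v\<close> and \<open>q\<close>-semilinear in \<open>w\<close> over \<open>F\<close>. On the
  diagonal the four monomials belong to the four roots of the check polynomial.\<close>

definition form :: "'a \<Rightarrow> 'a \<Rightarrow> 'a \<Rightarrow> 'a \<Rightarrow> 'a \<Rightarrow> 'a \<Rightarrow> 'a" where
  "form a b c d v w =
     a * w ^ q * (v ^ q) ^ q + b * ((w ^ q) ^ q) ^ q * v +
     c * ((w ^ q) ^ q) ^ q * (v ^ q) ^ q + d * w ^ q * v"

lemma form_add:
  "form a b c d (u + v) w = form a b c d u w + form a b c d v w"
  "form a b c d v (u + w) = form a b c d v u + form a b c d v w"
  unfolding form_def power_q_add by (simp_all add: distrib_left distrib_right add_ac)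

lemma form_scale:
  assumes "x \<in> F"
  shows "form a b c d (x * v) w = x * form a b c d v w"
    and "form a b c d v (x * w) = x ^ q * form a b c d v w"
  using assms by (simp_all add: form_def F_iff' power_mult_distrib algebra_simps)

text \<open>The zeros \<open>(x : y)\<close> of \<open>x * y\<^sup>q - x\<^sup>q * y\<close> form a subline over the field with \<open>q\<close> elements.\<close>
lemma form_three_zeros:
  assumes "form a b c d w1 w1 = 0" "form a b c d w2 w2 = 0" "form a b c d (w1 + w2) (w1 + w2) = 0"
    and "x \<in> F" "y \<in> F"
  shows "form a b c d (x * w1 + y * w2) (x * w1 + y * w2) = form a b c d w1 w2 * (x * y ^ q - x ^ q * y)"
proof -
  \<comment> \<open>In the expansion at \<open>w1 + w2\<close> the diagonal terms vanish, which
    leaves only the two mixed terms.\<close>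
  have "form a b c d w2 w1 = - form a b c d w1 w2"
    using assms(1-3) by (simp add: form_add add_eq_0_iff)
  thus ?thesis
    unfolding form_add form_scale[OF assms(4)] form_scale[OF assms(5)]
    using assms(1,2) by (simp add: algebra_simps)
qed

text \<open>Distinct indices mean that \<open>u\<close> and \<open>v\<close> are not proportional
  over \<open>F\<close>. The resulting injective map from \<open>F \<times> F\<close> is onto, as
  both sides have \<open>q ^ 4\<close> elements.\<close>

lemma plane_basis:
  assumes "u \<noteq> 0" "v \<noteq> 0" "idx u \<noteq> idx v"
  shows "\<exists>x\<in>F. \<exists>y\<in>F. w = x * u + y * v"
    and "x \<in> F \<Longrightarrow> y \<in> F \<Longrightarrow> x * u + y * v = 0 \<Longrightarrow> x = 0 \<and> y = 0"
proof -
  show indep: "x = 0 \<and> y = 0" if xy: "x \<in> F" "y \<in> F" "x * u + y * v = 0" for x y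
  proof -
    have "x = 0"
    proof (rule ccontr)
      assume x: "x \<noteq> 0"
      have "u = (- y / x) * v" using xy(3) x by (simp add: field_simps add_eq_0_iff)
      moreover have "- y / x \<in> F" using xy(1,2) by (intro F_closed)
      moreover from calculation assms(1) have "- y / x \<noteq> 0" by auto
      ultimately have "idx u = idx v" using idx_scale[OF assms(2), of "- y / x"] by simp
      thus False using assms(3) by simp
    qed
    thus ?thesis using xy(3) assms(2) by simp
  qed
  let ?f = "\<lambda>(x, y). x * u + y * v"
  have "inj_on ?f (F \<times> F)"
  proof (rule inj_onI)
    fix s t assume "s \<in> F \<times> F" "t \<in> F \<times> F" and eq: "?f s = ?f t"
    moreover obtain x y x' y' where st: "s = (x, y)" "t = (x', y')" by fastforce
    ultimately have F: "x \<in> F" "y \<in> F" "x' \<in> F" "y' \<in> F" by auto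
    have "(x - x') * u + (y - y') * v = 0" using eq st by (simp add: algebra_simps)
    with indep[of "x - x'" "y - y'"] F have "x - x' = 0 \<and> y - y' = 0" by (simp add: F_closed)
    thus "s = t" using st by simp
  qed
  hence "card (?f ` (F \<times> F)) = card (F \<times> F)" by (rule card_image)
  also have "\<dots> = card (UNIV :: 'a set)"
    by (simp add: card_cartesian_product card_F card_UNIV flip: power_add)
  finally have "?f ` (F \<times> F) = UNIV" by (intro card_subset_eq) auto
  hence "w \<in> ?f ` (F \<times> F)" by simp
  thus "\<exists>x\<in>F. \<exists>y\<in>F. w = x * u + y * v" by auto
qed

text \<open>The set \<open>Z\<close> is built from \<open>T\<close> alone, before any form is
  chosen: it consists of the indices of a subline over the field with \<open>q\<close>
  elements.\<close>

lemma circle_through: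
  assumes "T \<subseteq> {..<n}" "card T = 3"
  obtains Z where "Z \<subseteq> {..<n}" "card Z = q + 1"
    "\<And>a b c d. \<forall>i\<in>T. form a b c d (\<omega> ^ i) (\<omega> ^ i) = 0 \<Longrightarrow>
      \<exists>i<n. form a b c d (\<omega> ^ i) (\<omega> ^ i) \<noteq> 0 \<Longrightarrow>
      {i. i < n \<and> form a b c d (\<omega> ^ i) (\<omega> ^ i) = 0} = Z"
proof -
  obtain i j k where T: "T = {i, j, k}" "i \<noteq> j" "i \<noteq> k" "j \<noteq> k"
    using assms(2) by (auto simp: card_3_iff)
  have lt: "i < n" "j < n" "k < n" using T assms(1) by auto
  have idx_\<omega>: "idx (\<omega> ^ l) = l" if "l < n" for l
    using idx_unique[of 1 l] that F_closed(1) by simp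
  have \<omega>nz: "\<omega> ^ l \<noteq> 0" for l using \<omega>(1) by simp
  obtain x0 y0 where xy0: "x0 \<in> F" "y0 \<in> F" "\<omega> ^ k = x0 * \<omega> ^ i + y0 * \<omega> ^ j"
    using plane_basis(1)[OF \<omega>nz \<omega>nz, of i j] T lt idx_\<omega> by metis
  \<comment> \<open>The three coordinates are distinct, so \<open>\<omega> ^ k\<close> is
    proportional to neither of the other two vectors.\<close>
  have x0: "x0 \<noteq> 0"
  proof
    assume "x0 = 0"
    moreover from this xy0(3) \<omega>nz[of k] have "y0 \<noteq> 0" by auto
    ultimately have "idx (\<omega> ^ k) = idx (\<omega> ^ j)"
      using xy0 idx_scale[OF \<omega>nz, of y0 j] by simp
    thus False using T lt by (simp add: idx_\<omega>)
  qed
  have y0: "y0 \<noteq> 0"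
  proof
    assume "y0 = 0"
    hence "idx (\<omega> ^ k) = idx (\<omega> ^ i)"
      using xy0 x0 idx_scale[OF \<omega>nz, of x0 i] by simp
    thus False using T lt by (simp add: idx_\<omega>)
  qed
  \<comment> \<open>Absorbing the coefficients keeps the points and makes
    \<open>\<omega> ^ k\<close> equal to \<open>w1 + w2\<close>.\<close>
  define w1 w2 where "w1 = x0 * \<omega> ^ i" and "w2 = y0 * \<omega> ^ j"
  have w: "w1 \<noteq> 0" "w2 \<noteq> 0" "idx w1 \<noteq> idx w2"
    using x0 y0 \<omega>nz T lt xy0 by (auto simp: w1_def w2_def idx_scale idx_\<omega>)
  note indep = plane_basis(2)[OF w]
  \<comment> \<open>representatives of the subline through \<open>w1\<close>, \<open>w2\<close> and \<open>w1 + w2\<close>\<close>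
  define V where "V = insert w2 ((\<lambda>t. w1 + t * w2) ` subfield_of_order q)"
  have V_form: "\<exists>x\<in>F. \<exists>y\<in>F. v = x * w1 + y * w2 \<and> x * y ^ q = x ^ q * y" if vV: "v \<in> V" for v
  proof (cases "v = w2")
    case True
    thus ?thesis using F_closed(1,2) q(2) by (intro bexI[of _ 0] bexI[of _ 1]) (auto simp: power_0_left)
  next
    case False
    then obtain t where "t \<in> subfield_of_order q" "v = w1 + t * w2" using vV by (auto simp: V_def)
    thus ?thesis using F_closed(1) Fq_subset
      by (intro bexI[of _ 1] bexI[of _ t]) (auto simp: subfield_of_order_def)
  qed
  have nz: "w1 + t * w2 \<noteq> 0" if "t \<in> F" for t
    using indep[of 1 t] that F_closed(1) by auto
  have Vnz: "v \<noteq> 0" if "v \<in> V" for v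
    using that nz w(2) Fq_subset by (auto simp: V_def)
  have inj1: "t = t'" if tt: "t \<in> F" "t' \<in> F" "idx (w1 + t * w2) = idx (w1 + t' * w2)" for t t'
  proof -
    obtain s where s: "s \<in> F" "w1 + t * w2 = s * (w1 + t' * w2)"
      using idx_eqD[OF tt(3) nz[OF tt(1)] nz[OF tt(2)]] by blast
    hence "(1 - s) * w1 + (t - s * t') * w2 = 0" by (simp add: algebra_simps)
    with indep[of "1 - s" "t - s * t'"] s(1) tt(1,2)
    have "1 - s = 0 \<and> t - s * t' = 0" by (simp add: F_closed)
    thus ?thesis by simp
  qed
  have inj2: "idx (w1 + t * w2) \<noteq> idx w2" if t: "t \<in> F" for t
  proof
    assume eq: "idx (w1 + t * w2) = idx w2"
    obtain s where s: "s \<in> F" "w1 + t * w2 = s * w2" using idx_eqD[OF eq nz[OF t] w(2)] by blast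
    hence "1 * w1 + (t - s) * w2 = 0" by (simp add: algebra_simps)
    with indep[of 1 "t - s"] t s(1) show False by (simp add: F_closed)
  qed
  have inj_V: "inj_on idx V"
  proof (rule inj_onI)
    fix v v' assume vv: "v \<in> V" "v' \<in> V" and eq: "idx v = idx v'"
    have "u = w2 \<or> (\<exists>t\<in>F. u = w1 + t * w2)" if "u \<in> V" for u
      using that Fq_subset unfolding V_def by blast
    from this[OF vv(1)] this[OF vv(2)] consider "v = w2" "v' = w2"
      | t where "v = w1 + t * w2" "t \<in> F" "v' = w2"
      | t where "v' = w1 + t * w2" "t \<in> F" "v = w2"
      | t t' where "v = w1 + t * w2" "t \<in> F" "v' = w1 + t' * w2" "t' \<in> F"
      by blast
    thus "v = v'"
    proof cases
      case 2
      thus ?thesis using inj2 eq by metis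
    next
      case 3
      thus ?thesis using inj2 eq by metis
    next
      case 4
      thus ?thesis using inj1 eq by metis
    qed simp
  qed
  have "card V = q + 1"
  proof -
    have "w2 \<notin> (\<lambda>t. w1 + t * w2) ` subfield_of_order q"
    proof
      assume "w2 \<in> (\<lambda>t. w1 + t * w2) ` subfield_of_order q"
      then obtain t where t: "t \<in> subfield_of_order q" "w2 = w1 + t * w2" by blast
      thus False using inj2[of t] Fq_subset by auto
    qed
    moreover have "inj_on (\<lambda>t. w1 + t * w2) (subfield_of_order q)"
      using w(2) by (auto simp: inj_on_def)
    ultimately show ?thesis
      by (simp add: V_def card_image card_Fq)
  qed
  hence card: "card (idx ` V) = q + 1" using inj_V by (simp add: card_image)
  have sub: "idx ` V \<subseteq> {..<n}" using idx(1) Vnz by auto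
  have zeros: "{l. l < n \<and> form a b c d (\<omega> ^ l) (\<omega> ^ l) = 0} = idx ` V"
    if 0: "\<forall>i\<in>T. form a b c d (\<omega> ^ i) (\<omega> ^ i) = 0"
      and ex: "\<exists>i<n. form a b c d (\<omega> ^ i) (\<omega> ^ i) \<noteq> 0" for a b c d
  proof -
    let ?B = "form a b c d"
    have "?B w1 w1 = 0" "?B w2 w2 = 0"
      using 0 T xy0(1,2) by (auto simp: w1_def w2_def form_scale)
    moreover have "?B (w1 + w2) (w1 + w2) = 0"
      using 0 T xy0(3) by (simp add: w1_def w2_def)
    ultimately have B: "?B (x * w1 + y * w2) (x * w1 + y * w2) = ?B w1 w2 * (x * y ^ q - x ^ q * y)"
      if "x \<in> F" "y \<in> F" for x y
      using form_three_zeros that by blast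
    \<comment> \<open>Otherwise the form would vanish on the diagonal everywhere, against the
      assumed nonzero value.\<close>
    have B0: "?B w1 w2 \<noteq> 0"
    proof
      assume "?B w1 w2 = 0"
      hence "?B v v = 0" for v using plane_basis(1)[OF w, of v] B by auto
      thus False using ex by simp
    qed
    show ?thesis
    proof (intro equalityI subsetI)
      fix l assume "l \<in> {l. l < n \<and> ?B (\<omega> ^ l) (\<omega> ^ l) = 0}"
      hence l: "l < n" "?B (\<omega> ^ l) (\<omega> ^ l) = 0" by auto
      obtain x y where xy: "x \<in> F" "y \<in> F" "\<omega> ^ l = x * w1 + y * w2"
        using plane_basis(1)[OF w, of "\<omega> ^ l"] by blast
      have eq: "x * y ^ q = x ^ q * y" using l(2) B[OF xy(1,2)] B0 xy(3) by simp
      show "l \<in> idx ` V"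
      proof (cases "x = 0")
        case True
        hence "y \<noteq> 0" using xy(3) \<omega>nz[of l] by auto
        hence "idx w2 = l" using idx_scale[OF w(2) xy(2)] True xy(3) idx_\<omega>[OF l(1)] by simp
        thus ?thesis by (auto simp: V_def)
      next
        case False
        define t where "t = y / x"
        have t: "t \<in> F" using xy F_closed by (simp add: t_def)
        \<comment> \<open>Vanishing at \<open>(x, y)\<close> says precisely that the ratio lies in
          the subfield with \<open>q\<close> elements.\<close>
        have "t ^ q = t" using eq False by (simp add: t_def power_divide field_simps)
        hence tV: "w1 + t * w2 \<in> V" by (auto simp: V_def subfield_of_order_def)
        have "\<omega> ^ l = x * (w1 + t * w2)" using xy(3) False by (simp add: t_def field_simps)
        hence "idx (w1 + t * w2) = l"
          using idx_scale[OF nz[OF t] xy(1) False] idx_\<omega>[OF l(1)] by simp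
        thus ?thesis using tV by blast
      qed
    next
      fix l assume "l \<in> idx ` V"
      then obtain v where v: "v \<in> V" "l = idx v" by blast
      obtain x y where xy: "x \<in> F" "y \<in> F" "v = x * w1 + y * w2" "x * y ^ q = x ^ q * y"
        using V_form[OF v(1)] by blast
      obtain t where t: "t \<in> F" "t \<noteq> 0" "v = t * \<omega> ^ l"
        using idx(2)[OF Vnz[OF v(1)]] v(2) by blast
      have "?B v v = 0" using B[OF xy(1,2)] xy(3,4) by simp
      hence "t ^ q * (t * ?B (\<omega> ^ l) (\<omega> ^ l)) = 0" unfolding t(3) form_scale[OF t(1)] .
      hence "?B (\<omega> ^ l) (\<omega> ^ l) = 0" using t(2) by simp
      thus "l \<in> {l. l < n \<and> ?B (\<omega> ^ l) (\<omega> ^ l) = 0}"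
        using v sub by auto
    qed
  qed
  show ?thesis by (rule that[OF sub card zeros])
qed

end

context constacyclic_setting
begin

subsection \<open>The constacyclic code\<close>

text \<open>The polynomials over \<open>F\<close> are the fixed points of this ring endomorphism, so
  membership passes through products, quotients and remainders.\<close>

definition frob :: "'a poly \<Rightarrow> 'a poly" where
  "frob = map_poly (\<lambda>x. x ^ q\<^sup>2)"

lemma coeff_frob: "coeff (frob c) i = coeff c i ^ q\<^sup>2"
  using q(2) by (simp add: frob_def coeff_map_poly)

lemma power_q2_sum: "(sum f A :: 'a) ^ q\<^sup>2 = (\<Sum>i\<in>A. f i ^ q\<^sup>2)"
  unfolding power_q2
  by (induction A rule: infinite_finite_induct) (use q(2) in \<open>auto simp: power_q_add power_0_left\<close>)

lemma frob_mult: "frob (c * d) = frob c * frob d"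
  by (rule poly_eqI) (simp add: coeff_frob coeff_mult power_q2_sum power_mult_distrib)

lemma frob_add: "frob (c + d) = frob c + frob d"
  by (rule poly_eqI) (simp add: coeff_frob power_q2 power_q_add)

lemma frob_eq_iff: "frob c = c \<longleftrightarrow> (\<forall>i. coeff c i \<in> F)"
  by (simp add: poly_eq_iff coeff_frob F_iff)

lemma frob_linear: "frob [:- \<rho>, 1:] = [:- (\<rho> ^ q\<^sup>2), 1:]"
proof (rule poly_eqI)
  fix i
  show "coeff (frob [:- \<rho>, 1:]) i = coeff [:- (\<rho> ^ q\<^sup>2), 1:] i"
    using q(2) by (simp add: coeff_frob coeff_pCons power_q2 power_q_minus power_0_left split: nat.split)
qed

lemma degree_frob_le: "degree (frob c) \<le> degree c"
  using q(2) by (intro degree_le) (auto simp: coeff_frob coeff_eq_0 power_0_left)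

lemma frob_mult_cancel:
  assumes "frob (c * d) = c * d" "frob d = d" "d \<noteq> 0"
  shows "frob c = c"
  using assms by (simp add: frob_mult)

text \<open>Applying \<open>frob\<close> to the division identity gives a division by the same
  \<open>d\<close> with remainder \<open>frob (c mod d)\<close>; remainders are unique.\<close>

lemma frob_mod:
  assumes "frob c = c" "frob d = d" "d \<noteq> 0"
  shows "frob (c mod d) = c mod d"
proof (cases "degree d = 0")
  \<comment> \<open>For a constant divisor the remainder is 0, whose degree is not below that of
    \<open>d\<close>, so the degree argument needs this separate case.\<close>
  case True
  then obtain x where "d = [:x:]" by (rule degree_eq_zeroE)
  hence "c mod d = 0" using assms(3) by (simp add: mod_eq_0_iff_dvd is_unit_iff_degree unit_imp_dvd)
  thus ?thesis using q(2) by (auto simp: frob_eq_iff F_closed)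
next
  case False
  have "c = frob (c div d * d + c mod d)" by (simp add: assms(1))
  also have "\<dots> = frob (c div d) * d + frob (c mod d)"
    by (simp only: frob_add frob_mult assms(2))
  finally have "c mod d = frob (c mod d) mod d" by (metis mod_mult_self3)
  also have "degree (frob (c mod d)) < degree d"
    using degree_frob_le[of "c mod d"] degree_mod_less[OF assms(3), of c] False by auto
  hence "frob (c mod d) mod d = frob (c mod d)" by (rule mod_poly_less)
  finally show ?thesis by simp
qed

lemma words_iff:
  assumes "k > 0"
  shows "c \<in> words F k \<longleftrightarrow> frob c = c \<and> degree c < k"
proof -
  have "(\<forall>i\<ge>k. coeff c i = 0) \<longleftrightarrow> degree c < k"
  proof
    assume 0: "\<forall>i\<ge>k. coeff c i = 0"
    show "degree c < k"
    proof (rule ccontr)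
      assume "\<not> degree c < k"
      hence "lead_coeff c = 0" using 0 by simp
      hence "c = 0" by (simp only: leading_coeff_0_iff)
      thus False using \<open>\<not> degree c < k\<close> assms by simp
    qed
  next
    assume "degree c < k"
    thus "\<forall>i\<ge>k. coeff c i = 0" by (auto intro: coeff_eq_0)
  qed
  thus ?thesis by (simp add: words_def frob_eq_iff)
qed

section \<open>The code as multiples of its generator polynomial\<close>

abbreviation X :: "'a poly" where "X \<equiv> monom 1 n - [:lam:]"

text \<open>Exponents congruent to 1 modulo \<open>q + 1\<close> fix \<open>lam\<close>. This puts
  \<open>lam\<close> into \<open>F\<close> and later yields the roots of \<open>X\<close>.\<close>

lemma lam_power: "lam ^ (1 + (q + 1) * j) = lam"
proof -
  have "r dvd (q + 1) * j" using r(1) by (rule dvd_mult2)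
  hence "lam ^ ((q + 1) * j) = 1" using power_eq_1_iff_mult_ord_dvd[OF lam(1)] lam(2) by simp
  thus ?thesis by (simp only: power_add power_one_right mult_1_right)
qed

lemma n_pos: "n > 0"
  by (simp add: n)

lemma degree_X: "degree X = n"
proof -
  have "degree (monom 1 n + [:- lam:]) = degree (monom (1::'a) n)"
    using n_pos by (intro degree_add_eq_left) (simp add: degree_monom_eq)
  moreover have "monom 1 n + [:- lam:] = X" by simp
  ultimately show ?thesis by (simp only: degree_monom_eq one_neq_zero not_False_eq_True)
qed

lemma frob_X: "frob X = X"
proof -
  have "lam ^ (1 + (q + 1) * (q - 1)) = lam" by (rule lam_power)
  moreover have "1 + (q + 1) * (q - 1) = q\<^sup>2"
    using q(2) by (cases q) (auto simp: power2_eq_square)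
  ultimately have "lam \<in> F" by (simp only: F_iff)
  thus ?thesis
    by (auto simp: frob_eq_iff coeff_pCons F_closed split: nat.split intro!: F_closed)
qed

context
  fixes h :: "'a poly"
  assumes h: "h dvd X" "frob h = h" "degree h = 4"
begin

lemma check_h_nonzero: "h \<noteq> 0"
  using h(3) by auto

lemma check_X: "X div h * h = X"
  using h(1) by (rule dvd_div_mult_self)

lemma check_g_nonzero: "X div h \<noteq> 0"
proof
  assume "X div h = 0"
  hence "X = 0" using check_X by (simp only: mult_zero_left)
  thus False using degree_X n_pos by (simp only: degree_0)
qed

lemma frob_check_g: "frob (X div h) = X div h"
  by (rule frob_mult_cancel[of "X div h" h, unfolded check_X, OF frob_X h(2) check_h_nonzero])

lemma degree_check_g: "degree (X div h) + 4 = n"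
proof -
  have "degree (X div h * h) = degree (X div h) + degree h"
    by (rule degree_mult_eq[OF check_g_nonzero check_h_nonzero])
  thus ?thesis unfolding check_X degree_X h(3) by (rule sym)
qed

text \<open>Reducing \<open>a * g\<close> modulo \<open>h * g\<close> gives
  \<open>g * (a mod h)\<close>, so multipliers of degree below 4 suffice; their products have degree
  below \<open>n\<close> and need no reduction.\<close>

lemma constacyclic_code_check_eq:
  "constacyclic_code_check F n lam h = (\<lambda>s. X div h * s) ` words F 4"
proof (intro equalityI subsetI)
  fix c assume "c \<in> constacyclic_code_check F n lam h"
  then obtain a where a: "\<forall>i. coeff a i \<in> F" "c = (a * (X div h)) mod X"
    unfolding constacyclic_code_check_def constacyclic_code_gen_def by blast
  have "c = (a * (X div h)) mod (h * (X div h))" unfolding a(2) by (simp only: check_X mult.commute[of h])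
  hence "c = X div h * (a mod h)" by (simp only: mod_mult_mult2 mult.commute)
  moreover have "a mod h \<in> words F 4"
  proof -
    have "frob (a mod h) = a mod h"
      using a(1) h(2) check_h_nonzero by (intro frob_mod) (simp_all add: frob_eq_iff)
    moreover have "degree (a mod h) < 4"
      using degree_mod_less[OF check_h_nonzero, of a] h(3) by auto
    ultimately show ?thesis by (simp add: words_iff)
  qed
  ultimately show "c \<in> (\<lambda>s. X div h * s) ` words F 4" by blast
next
  fix c assume "c \<in> (\<lambda>s. X div h * s) ` words F 4"
  then obtain s where s: "frob s = s" "degree s < 4" "c = X div h * s"
    by (auto simp: words_iff)
  have frob: "frob c = c" by (simp add: s frob_mult frob_check_g)
  have "degree c \<le> degree (X div h) + degree s" unfolding s(3) by (rule degree_mult_le)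
  hence deg: "degree c < n" using s(2) degree_check_g by linarith
  hence "c mod X = c" by (intro mod_poly_less) (simp add: degree_X)
  moreover have "c = s * (X div h)" by (simp add: s(3))
  moreover have "c \<in> words F n" using frob deg n_pos by (simp add: words_iff)
  moreover have "\<forall>i. coeff s i \<in> F" using s(1) frob_eq_iff by blast
  ultimately show "c \<in> constacyclic_code_check F n lam h"
    unfolding constacyclic_code_check_def constacyclic_code_gen_def by auto
qed

end

section \<open>The four roots of the check polynomial\<close>

definition \<rho>1 where "\<rho>1 = \<delta>"
definition \<rho>2 where "\<rho>2 = \<delta> ^ q\<^sup>2"
definition \<rho>3 where "\<rho>3 = \<delta> ^ (q\<^sup>2 + q + 1)"
definition \<rho>4 where "\<rho>4 = \<delta> ^ (q ^ 4 + q ^ 3 + q\<^sup>2)"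

text \<open>The order of \<open>\<delta>\<close> is a multiple of \<open>n\<close>, so exponents of
  equal powers agree modulo \<open>n\<close>. Integers allow either exponent to be the
  larger.\<close>

lemma \<delta>_power_eqD:
  assumes "\<delta> ^ a = \<delta> ^ b"
  shows "int n dvd int b - int a"
  using assms
proof (induction a b rule: linorder_wlog)
  case (le a b)
  have "\<delta> ^ b = \<delta> ^ a * \<delta> ^ (b - a)" using le.hyps by (simp flip: power_add)
  hence "\<delta> ^ (b - a) = 1" using le.prems \<delta>_nonzero by simp
  hence "n dvd b - a" unfolding \<delta>_power_eq_1 by (rule dvd_mult_right)
  hence "int n dvd int (b - a)" by (simp only: of_nat_dvd_iff)
  thus ?case using le.hyps by (simp add: of_nat_diff)
next
  case (sym a b)
  thus ?case by (metis dvd_diff_commute)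
qed

text \<open>Modulo \<open>n\<close> one has \<open>q^2 = -1\<close>, so the exponents reduce to 1,
  -1, \<open>q\<close>, \<open>-q\<close>. Up to sign and multiples of \<open>n\<close> their
  differences are the positive numbers below \<open>n\<close> listed in \<open>s\<close>.\<close>

lemma \<rho>_distinct: "distinct [\<rho>1, \<rho>2, \<rho>3, \<rho>4]"
proof -
  define Q where "Q = int q"
  have Q: "Q > 2" using q(2) by (simp add: Q_def)
  have N: "int n = Q\<^sup>2 + 1" by (simp add: n Q_def)
  have QQ: "Q * 2 < Q * Q" using Q by (intro mult_strict_left_mono) auto
  have small: "\<not> int n dvd k" if "0 < k" "k < Q\<^sup>2 + 1" for k
    using that by (intro zdvd_not_zless) (auto simp: N)
  have red: "\<not> int n dvd k" if "\<not> int n dvd j" "k = int n * l + j \<or> k = int n * l - j" for j k l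
    using that by (auto simp: dvd_add_right_iff dvd_diff_right_iff)
  have "Q < Q * Q" using Q QQ by linarith
  hence s: "\<not> int n dvd Q\<^sup>2 - 1" "\<not> int n dvd Q - 1" "\<not> int n dvd Q + 1" "\<not> int n dvd 2 * Q"
    using Q QQ unfolding power2_eq_square
    by - (rule small, unfold power2_eq_square, linarith, linarith)+
  have s': "\<not> int n dvd Q\<^sup>2 + Q" by (rule red[OF s(2), of _ 1]) (simp add: N)
  have "\<rho>1 \<noteq> \<rho>2" using \<delta>_power_eqD[of 1 "q\<^sup>2"] s(1) by (auto simp: \<rho>1_def \<rho>2_def Q_def)
  moreover have "\<rho>1 \<noteq> \<rho>3" using \<delta>_power_eqD[of 1 "q\<^sup>2 + q + 1"] s' by (auto simp: \<rho>1_def \<rho>3_def Q_def)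
  moreover have "\<rho>2 \<noteq> \<rho>3"
  proof
    assume "\<rho>2 = \<rho>3"
    hence "int n dvd int (q\<^sup>2 + q + 1) - int (q\<^sup>2)"
      unfolding \<rho>2_def \<rho>3_def by (rule \<delta>_power_eqD)
    moreover have "int (q\<^sup>2 + q + 1) - int (q\<^sup>2) = Q + 1" by (simp add: Q_def)
    ultimately show False using s(3) by (simp only:)
  qed
  moreover have "\<rho>1 \<noteq> \<rho>4"
  proof
    assume "\<rho>1 = \<rho>4"
    hence "int n dvd Q ^ 4 + Q ^ 3 + Q\<^sup>2 - 1"
      using \<delta>_power_eqD[of 1 "q ^ 4 + q ^ 3 + q\<^sup>2"] by (simp add: \<rho>1_def \<rho>4_def Q_def)
    moreover have "Q ^ 4 + Q ^ 3 + Q\<^sup>2 - 1 = int n * (Q\<^sup>2 + Q) - (Q + 1)" unfolding N by algebra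
    ultimately show False using red[OF s(3)] by blast
  qed
  moreover have "\<rho>2 \<noteq> \<rho>4"
  proof
    assume "\<rho>2 = \<rho>4"
    hence "int n dvd Q ^ 4 + Q ^ 3"
      using \<delta>_power_eqD[of "q\<^sup>2" "q ^ 4 + q ^ 3 + q\<^sup>2"] by (simp add: \<rho>2_def \<rho>4_def Q_def)
    moreover have "Q ^ 4 + Q ^ 3 = int n * (Q\<^sup>2 + Q) - (Q\<^sup>2 + Q)" unfolding N by algebra
    ultimately show False using red[OF s'] by blast
  qed
  moreover have "\<rho>3 \<noteq> \<rho>4"
  proof
    assume "\<rho>3 = \<rho>4"
    hence "int n dvd int (q ^ 4 + q ^ 3 + q\<^sup>2) - int (q\<^sup>2 + q + 1)"
      unfolding \<rho>3_def \<rho>4_def by (rule \<delta>_power_eqD)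
    moreover have "int (q ^ 4 + q ^ 3 + q\<^sup>2) - int (q\<^sup>2 + q + 1) = int n * (Q\<^sup>2 + Q - 1) - 2 * Q"
      unfolding N of_nat_add of_nat_power of_nat_1 Q_def[symmetric] by algebra
    ultimately show False using red[OF s(4)] by metis
  qed
  ultimately show ?thesis by simp
qed

text \<open>All four exponents are congruent to 1 modulo \<open>q + 1\<close>, so
  \<open>lam_power\<close> applies.\<close>

lemma \<rho>_root: "poly X \<rho>1 = 0" "poly X \<rho>2 = 0" "poly X \<rho>3 = 0" "poly X \<rho>4 = 0"
proof -
  have "(\<delta> ^ (1 + (q + 1) * j)) ^ n = lam" for j
  proof -
    have "(\<delta> ^ (1 + (q + 1) * j)) ^ n = (\<delta> ^ n) ^ (1 + (q + 1) * j)"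
      by (simp only: power_mult[symmetric] mult.commute)
    thus ?thesis by (simp only: \<delta>(2) lam_power)
  qed
  hence root: "poly X (\<delta> ^ k) = 0" if "k = 1 + (q + 1) * j" for j k
    using that by (simp add: poly_monom del: power_Suc)
  have q1: "1 + (q + 1) * (q - 1) = q\<^sup>2"
    using q(2) by (cases q) (auto simp: power2_eq_square)
  show "poly X \<rho>1 = 0" using root[of 1 0] by (simp add: \<rho>1_def)
  show "poly X \<rho>2 = 0" unfolding \<rho>2_def using q1 by (intro root[of _ "q - 1"]) simp
  show "poly X \<rho>3 = 0"
    unfolding \<rho>3_def by (intro root[of _ q]) (simp add: power2_eq_square)
  have "q ^ 4 + q ^ 3 + q\<^sup>2 = 1 + (q + 1) * (q ^ 3 + (q - 1))"
    unfolding q1[symmetric] by (simp add: algebra_simps power4_eq_xxxx power3_eq_cube)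
  thus "poly X \<rho>4 = 0" unfolding \<rho>4_def by (rule root)
qed

lemma \<rho>_nonzero: "0 \<notin> {\<rho>1, \<rho>2, \<rho>3, \<rho>4}"
  using \<delta>_nonzero by (auto simp: \<rho>1_def \<rho>2_def \<rho>3_def \<rho>4_def)

definition h :: "'a poly" where
  "h = [:-\<rho>1, 1:] * [:-\<rho>2, 1:] * ([:-\<rho>3, 1:] * [:-\<rho>4, 1:])"

lemma h_prod: "h = (\<Prod>\<rho>\<in>{\<rho>1, \<rho>2, \<rho>3, \<rho>4}. [:-\<rho>, 1:])"
  using \<rho>_distinct unfolding h_def by (simp add: mult.assoc del: mult_pCons_left mult_pCons_right)

lemma card_\<rho>: "card {\<rho>1, \<rho>2, \<rho>3, \<rho>4} = 4"
  using \<rho>_distinct by simp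

text \<open>Raising to the power \<open>q\<^sup>2\<close> swaps \<open>\<rho>1\<close> with
  \<open>\<rho>2\<close> and \<open>\<rho>3\<close> with \<open>\<rho>4\<close>, so the product has
  coefficients in \<open>F\<close>.\<close>

lemma h_props: "h dvd X" "frob h = h" "degree h = 4"
proof -
  show "h dvd X" unfolding h_prod using \<rho>_root by (intro prod_roots_dvd) auto
  show "degree h = 4" unfolding h_prod degree_prod_roots card_\<rho> ..
  have f1: "\<rho>1 ^ q\<^sup>2 = \<rho>2" by (simp add: \<rho>1_def \<rho>2_def)
  have f2: "\<rho>2 ^ q\<^sup>2 = \<rho>1" unfolding \<rho>1_def \<rho>2_def by (simp only: power_q2 power_q_4)
  have f3: "\<rho>3 ^ q\<^sup>2 = \<rho>4"
  proof -
    have "(q\<^sup>2 + q + 1) * q\<^sup>2 = q ^ 4 + q ^ 3 + q\<^sup>2"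
      by (simp add: algebra_simps power2_eq_square power3_eq_cube power4_eq_xxxx)
    thus ?thesis unfolding \<rho>3_def \<rho>4_def by (simp only: power_mult[symmetric])
  qed
  have f4: "\<rho>4 ^ q\<^sup>2 = \<rho>3" unfolding f3[symmetric] by (simp only: power_q2 power_q_4)
  show "frob h = h"
    unfolding h_def frob_mult frob_linear f1 f2 f3 f4 by (simp only: mult_ac)
qed

text \<open>Since \<open>1 / \<delta>\<close> is \<open>\<omega> ^ (q - 1)\<close>, every
  \<open>(1 / \<rho>) ^ i\<close> is a power of \<open>\<omega> ^ i\<close>. The common factor with
  exponent \<open>q\<^sup>2 + 1\<close> makes these the monomials of \<open>form\<close>.\<close>

lemma code_form:
  assumes "s \<in> words F 4"
  shows "\<exists>a b c d. \<forall>i<n. coeff (X div h * s) i * (\<omega> ^ i) ^ (q\<^sup>2 + 1) = form a b c d (\<omega> ^ i) (\<omega> ^ i)"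
proof -
  have "degree s < card {\<rho>1, \<rho>2, \<rho>3, \<rho>4}"
    using assms by (simp only: words_iff card_\<rho> zero_less_numeral)
  moreover have "X div h * (\<Prod>\<rho>\<in>{\<rho>1, \<rho>2, \<rho>3, \<rho>4}. [:-\<rho>, 1:]) = X"
    unfolding h_prod[symmetric] using h_props(1) by simp
  ultimately obtain a where a: "\<And>i. i < n \<Longrightarrow>
      coeff (X div h * s) i = (\<Sum>\<rho>\<in>{\<rho>1, \<rho>2, \<rho>3, \<rho>4}. a \<rho> * (1 / \<rho>) ^ i)"
    using coeff_check_poly_code[OF _ \<rho>_nonzero, of s "X div h" n lam] by auto
  have "coeff (X div h * s) i * (\<omega> ^ i) ^ (q\<^sup>2 + 1) = form (a \<rho>1) (a \<rho>2) (a \<rho>3) (a \<rho>4) (\<omega> ^ i) (\<omega> ^ i)"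
    if i: "i < n" for i
  proof -
    define w where "w = \<omega> ^ i"
    have pow: "(1 / \<delta> ^ k) ^ i * w ^ (q\<^sup>2 + 1) = w ^ ((q - 1) * k + (q\<^sup>2 + 1))" for k
    proof -
      have "(1 / \<delta> ^ k) ^ i = ((1 / \<delta>) ^ k) ^ i" by (simp only: power_one_over)
      also have "\<dots> = w ^ ((q - 1) * k)"
        unfolding \<omega>(2)[symmetric] w_def by (simp only: power_mult[symmetric] mult_ac)
      finally show ?thesis by (simp only: power_add)
    qed
    obtain k where k: "q = Suc k" using q(2) by (cases q) auto
    \<comment> \<open>The last exponent \<open>q ^ 4 * q + 1\<close> acts as \<open>q + 1\<close>,
      because \<open>w ^ q ^ 4 = w\<close>.\<close>
    have e: "(q - 1) * 1 + (q\<^sup>2 + 1) = q + q\<^sup>2" "(q - 1) * q\<^sup>2 + (q\<^sup>2 + 1) = q ^ 3 + 1"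
      "(q - 1) * (q\<^sup>2 + q + 1) + (q\<^sup>2 + 1) = q ^ 3 + q\<^sup>2"
      "(q - 1) * (q ^ 4 + q ^ 3 + q\<^sup>2) + (q\<^sup>2 + 1) = q ^ 4 * q + 1"
      by (simp_all add: k algebra_simps power2_eq_square power3_eq_cube power4_eq_xxxx)
    have m1: "(1 / \<rho>1) ^ i * w ^ (q\<^sup>2 + 1) = w ^ q * (w ^ q) ^ q"
      using pow[of 1] unfolding e by (simp add: \<rho>1_def power_add power_q2)
    have m2: "(1 / \<rho>2) ^ i * w ^ (q\<^sup>2 + 1) = ((w ^ q) ^ q) ^ q * w"
      unfolding \<rho>2_def pow e by (simp only: power_add power_q3 power_one_right)
    have m3: "(1 / \<rho>3) ^ i * w ^ (q\<^sup>2 + 1) = ((w ^ q) ^ q) ^ q * (w ^ q) ^ q"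
      unfolding \<rho>3_def pow e by (simp only: power_add power_q3 power_q2)
    have m4: "(1 / \<rho>4) ^ i * w ^ (q\<^sup>2 + 1) = w ^ q * w"
      unfolding \<rho>4_def pow e by (simp only: power_add power_mult power_q4 power_one_right)
    have "coeff (X div h * s) i * w ^ (q\<^sup>2 + 1) =
        a \<rho>1 * ((1 / \<rho>1) ^ i * w ^ (q\<^sup>2 + 1)) + a \<rho>2 * ((1 / \<rho>2) ^ i * w ^ (q\<^sup>2 + 1)) +
        a \<rho>3 * ((1 / \<rho>3) ^ i * w ^ (q\<^sup>2 + 1)) + a \<rho>4 * ((1 / \<rho>4) ^ i * w ^ (q\<^sup>2 + 1))"
      unfolding a[OF i] using \<rho>_distinct
      by (simp add: distrib_right add.assoc mult.assoc del: power_Suc power_one_over)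
    also have "\<dots> = form (a \<rho>1) (a \<rho>2) (a \<rho>3) (a \<rho>4) w w"
      unfolding m1 m2 m3 m4 form_def by (simp only: mult.assoc)
    finally show ?thesis by (simp only: w_def)
  qed
  thus ?thesis by blast
qed

text \<open>Multiplication by the generator is injective, which gives the size. The factor relating
  coordinates to form values is nonzero, so zeros correspond and \<open>circle_through\<close>
  supplies the circles.\<close>

lemma circle_code: "circle_code F (constacyclic_code_check F n lam h) q n"
proof -
  let ?g = "X div h" and ?C = "constacyclic_code_check F n lam h"
  note code = constacyclic_code_check_eq[OF h_props]
  note g0 = check_g_nonzero[OF h_props]
  show ?thesis
  proof
    show "card ?C = card F ^ 4"
    proof -
      have "card ?C = card (words F 4)"
        unfolding code using g0 by (intro card_image) (auto simp: inj_on_def)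
      thus ?thesis
        by (simp add: words_conv_words_on card_words_on F_closed)
    qed
    show "?C \<subseteq> words F n"
      by (auto simp: constacyclic_code_check_def constacyclic_code_gen_def)
    fix c d assume "c \<in> ?C" "d \<in> ?C"
    then obtain s t where st: "s \<in> words F 4" "t \<in> words F 4" "c = ?g * s" "d = ?g * t"
      unfolding code by blast
    have "s - t \<in> words F 4" using st(1,2) by (auto simp: words_def intro: F_closed)
    moreover have "c - d = ?g * (s - t)" by (simp add: st algebra_simps)
    ultimately show "c - d \<in> ?C" unfolding code by blast
  next
    fix x c assume x: "x \<in> F" and "c \<in> ?C"
    then obtain s where s: "s \<in> words F 4" "c = ?g * s"
      unfolding code by blast
    have "smult x s \<in> words F 4" using s(1) x by (auto simp: words_def intro: F_closed)
    moreover have "smult x c = ?g * smult x s" by (simp add: s)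
    ultimately show "smult x c \<in> ?C" unfolding code by blast
  next
    fix T assume T: "T \<subseteq> {..<n}" "card T = 3"
    obtain Z where Z: "Z \<subseteq> {..<n}" "card Z = q + 1"
      "\<And>a b c d. \<forall>i\<in>T. form a b c d (\<omega> ^ i) (\<omega> ^ i) = 0 \<Longrightarrow>
        \<exists>i<n. form a b c d (\<omega> ^ i) (\<omega> ^ i) \<noteq> 0 \<Longrightarrow>
        {i. i < n \<and> form a b c d (\<omega> ^ i) (\<omega> ^ i) = 0} = Z"
      by (rule circle_through[OF T]) (rule that)
    have "{i. i < n \<and> coeff c i = 0} = Z"
      if c: "c \<in> ?C" "c \<noteq> 0" "\<forall>i\<in>T. coeff c i = 0" for c
    proof -
      obtain s where s: "s \<in> words F 4" "c = ?g * s" using c(1) unfolding code by blast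
      obtain a1 a2 a3 a4 where
        form: "\<And>i. i < n \<Longrightarrow> coeff c i * (\<omega> ^ i) ^ (q\<^sup>2 + 1) = form a1 a2 a3 a4 (\<omega> ^ i) (\<omega> ^ i)"
        using code_form[OF s(1)] unfolding s(2)[symmetric] by blast
      have iff: "form a1 a2 a3 a4 (\<omega> ^ i) (\<omega> ^ i) = 0 \<longleftrightarrow> coeff c i = 0" if "i < n" for i
        using \<omega>(1) by (simp flip: form[OF that])
      have "c \<in> words F n"
        using c(1) by (auto simp: constacyclic_code_check_def constacyclic_code_gen_def)
      hence "\<exists>i<n. coeff c i \<noteq> 0"
        using c(2) by (metis (mono_tags, lifting) mem_Collect_eq not_le poly_eqI coeff_0 words_def)
      hence "\<exists>i<n. form a1 a2 a3 a4 (\<omega> ^ i) (\<omega> ^ i) \<noteq> 0" using iff by auto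
      moreover have "\<forall>i\<in>T. form a1 a2 a3 a4 (\<omega> ^ i) (\<omega> ^ i) = 0"
        using iff c(3) T(1) by auto
      ultimately have "{i. i < n \<and> form a1 a2 a3 a4 (\<omega> ^ i) (\<omega> ^ i) = 0} = Z" by (intro Z(3))
      thus ?thesis using iff by auto
    qed
    thus "\<exists>Z\<subseteq>{..<n}. card Z = q + 1 \<and> (\<forall>c\<in>?C. c \<noteq> 0 \<longrightarrow> (\<forall>i\<in>T. coeff c i = 0) \<longrightarrow>
        {i. i < n \<and> coeff c i = 0} = Z)"
      using Z(1,2) by blast
  qed (rule F_closed card_F q(2) n; assumption)+
qed

end

theorem theorem3p2:
  fixes p m q n r :: nat and lam \<delta> :: "'a::{field,finite}"
  assumes "prime p" and "m > 0" and "q = p ^ m" and "q > 2" and "n = q^2 + 1"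
    and "card (UNIV :: 'a set) = q ^ 4"
    and "lam \<in> subfield_of_order (q^2)" and "lam \<noteq> 0"
    and "mult_ord lam = r" and "r dvd (q + 1)"
    and "multiplicity (2::nat) r = multiplicity (2::nat) (q + 1)"
    and "mult_ord \<delta> = r * n" and "\<delta> ^ n = lam"
  defines "F \<equiv> subfield_of_order (q^2) :: 'a set"
    and "g1 \<equiv> [:-\<delta>, 1:] * [:-(\<delta> ^ (q^2)), 1:]"
    and "g2 \<equiv> [:-(\<delta> ^ (q^2+q+1)), 1:] * [:-(\<delta> ^ (q^4+q^3+q^2)), 1:]"
  defines "C \<equiv> constacyclic_code_check F n lam (g1 * g2)"
  shows "code_dim F C = 4 \<and> min_dist C = q^2 - q
      \<and> weight_enumerator C =
          1 + monom (int q ^ 5 - int q) (q^2 - q)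
            + monom ((int q ^ 4 - 1) * (int q - 1) * int q ^ 3 div 2) (q^2 - 1)
            + monom ((int q ^ 4 - 1) * (int q - 1) * int q ^ 3 div 2) (q^2 + 1)
            + monom (int q ^ 7 - int q ^ 5 + int q ^ 4 - int q ^ 3 + int q - 1) (q^2)
      \<and> is_t_design 3 (q^2 + 1) (q^2 - q) ((q^2 - q - 1) * (q - 2)) (min_weight_supports C)
      \<and> code_dim F (dual_code F n C) = q^2 - 3
      \<and> min_dist (dual_code F n C) = 4
      \<and> is_t_design 3 (q^2 + 1) 4 (q - 2) (min_weight_supports (dual_code F n C))"
proof -
  interpret E: constacyclic_setting p m q n r lam \<delta>
    using assms(1-13) by unfold_locales auto
  have h: "g1 * g2 = E.h"
    unfolding g1_def g2_def E.h_def E.\<rho>1_def E.\<rho>2_def E.\<rho>3_def E.\<rho>4_def ..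
  interpret K: circle_code F C q n
    unfolding F_def C_def h by (rule E.circle_code)
  have "is_t_design 3 (q^2 + 1) (q^2 - q) ((q^2 - q - 1) * (q - 2)) (min_weight_supports C)"
    unfolding K.min_weight_supports_code
    using assms(4) by (intro inversive_plane_complement K.circles_design) simp
  thus ?thesis
    by (intro conjI K.code_dims K.min_dist_code K.weight_enumerator_code K.min_dist_dual K.dual_design)
qed

end
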